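(* Let $T$ be a tree of order $n\geq 9$ and let $\mu\neq 1$ be a Laplacian eigenvalue of $T$. Then $m_T(\mu)=\frac{n-1}{2}-2$ if and only if $T\cong T\!\left(\frac{n-1}{2}+1,\frac{n-1}{2}-1\right)$ and $\mu=\frac{3\pm\sqrt{5}}{2}$. In particular, in this case $\mu$ is the algebraic connectivity $\mu_2(T)$ of $T$ or its conjugate.
   Context: For a graph $G$ on $n$ vertices, the Laplacian matrix is $L(G)=D(G)-A(G)$, with $D(G)$ the diagonal degree matrix and $A(G)$ the adjacency matrix. Its eigenvalues are denoted $0=\mu_1(G)\leq\mu_2(G)\leq\cdots\leq\mu_n(G)$; $\mu_2(G)$ is the algebraic connectivity, and $m_G(\mu)$ denotes the multiplicity of $\mu$ as an eigenvalue of $L(G)$. Two Laplacian eigenvalues are conjugates if they are roots of the same irreducible (over $\mathbb{Q}$) factor of the characteristic polynomial of $L(G)$. For integers $1\leq k\leq s$, the spider $T(s,k)$ is the tree obtained from the star $K_{1,s}$ by extending $k$ of its $s$ rays by one extra edge each; it has $s+k+1$ vertices. *)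

theory Defs
  imports "Jordan_Normal_Form.Char_Poly" "HOL-Computational_Algebra.Polynomial"
begin

definition simple_graph :: "nat \<Rightarrow> (nat \<Rightarrow> nat \<Rightarrow> bool) \<Rightarrow> bool" where
  "simple_graph n E \<longleftrightarrow> (\<forall>i j. E i j \<longrightarrow> i < n \<and> j < n \<and> i \<noteq> j \<and> E j i)"

definition connected_graph :: "nat \<Rightarrow> (nat \<Rightarrow> nat \<Rightarrow> bool) \<Rightarrow> bool" where
  "connected_graph n E \<longleftrightarrow> (\<forall>i<n. \<forall>j<n. E\<^sup>*\<^sup>* i j)"

definition is_cycle :: "nat \<Rightarrow> (nat \<Rightarrow> nat \<Rightarrow> bool) \<Rightarrow> nat list \<Rightarrow> bool" where
  "is_cycle n E vs \<longleftrightarrow> length vs \<ge> 3 \<and> distinct vs \<and> set vs \<subseteq> {0..<n}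
     \<and> (\<forall>i. Suc i < length vs \<longrightarrow> E (vs ! i) (vs ! Suc i)) \<and> E (last vs) (hd vs)"

definition is_tree :: "nat \<Rightarrow> (nat \<Rightarrow> nat \<Rightarrow> bool) \<Rightarrow> bool" where
  "is_tree n E \<longleftrightarrow> n \<ge> 1 \<and> simple_graph n E \<and> connected_graph n E \<and> (\<nexists>vs. is_cycle n E vs)"

definition graph_iso :: "nat \<Rightarrow> (nat \<Rightarrow> nat \<Rightarrow> bool) \<Rightarrow> nat \<Rightarrow> (nat \<Rightarrow> nat \<Rightarrow> bool) \<Rightarrow> bool" where
  "graph_iso n E m F \<longleftrightarrow> (\<exists>f. bij_betw f {0..<n} {0..<m}
      \<and> (\<forall>i<n. \<forall>j<n. E i j \<longleftrightarrow> F (f i) (f j)))"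

definition degree :: "nat \<Rightarrow> (nat \<Rightarrow> nat \<Rightarrow> bool) \<Rightarrow> nat \<Rightarrow> nat" where
  "degree n E i = card {j. j < n \<and> E i j}"

definition laplacian :: "nat \<Rightarrow> (nat \<Rightarrow> nat \<Rightarrow> bool) \<Rightarrow> 'a :: comm_ring_1 mat" where
  "laplacian n E = mat n n (\<lambda>(i, j). if i = j then of_nat (degree n E i)
                                    else if E i j then -1 else 0)"

definition lap_mult :: "nat \<Rightarrow> (nat \<Rightarrow> nat \<Rightarrow> bool) \<Rightarrow> real \<Rightarrow> nat" where
  "lap_mult n E \<mu> = order \<mu> (char_poly (laplacian n E :: real mat))"

text \<open>Laplacian eigenvalues with multiplicity, in nondecreasing order
  mu_1 <= mu_2 <= ... (list index 0 = mu_1).\<close>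
definition lap_spectrum :: "nat \<Rightarrow> (nat \<Rightarrow> nat \<Rightarrow> bool) \<Rightarrow> real list" where
  "lap_spectrum n E = sorted_list_of_multiset (proots (char_poly (laplacian n E :: real mat)))"

definition alg_conn :: "nat \<Rightarrow> (nat \<Rightarrow> nat \<Rightarrow> bool) \<Rightarrow> real" where
  "alg_conn n E = lap_spectrum n E ! 1"

definition lap_conjugate :: "nat \<Rightarrow> (nat \<Rightarrow> nat \<Rightarrow> bool) \<Rightarrow> real \<Rightarrow> real \<Rightarrow> bool" where
  "lap_conjugate n E \<mu> \<nu> \<longleftrightarrow> (\<exists>q :: rat poly. irreducible q
      \<and> q dvd char_poly (laplacian n E :: rat mat)
      \<and> poly (map_poly of_rat q) \<mu> = 0 \<and> poly (map_poly of_rat q) \<nu> = 0)"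

text \<open>Spider T(s,k): center 0, neighbours 1..s of the center, and for
  1 <= i <= k the extra vertex s+i attached to i.  Vertex set {0..<s+k+1}.\<close>
definition spider_edge :: "nat \<Rightarrow> nat \<Rightarrow> nat \<Rightarrow> nat \<Rightarrow> bool" where
  "spider_edge s k u v \<longleftrightarrow>
     (u = 0 \<and> 1 \<le> v \<and> v \<le> s) \<or> (v = 0 \<and> 1 \<le> u \<and> u \<le> s)
   \<or> (1 \<le> u \<and> u \<le> k \<and> v = s + u) \<or> (1 \<le> v \<and> v \<le> k \<and> u = s + v)"

end

theory Submission
  imports Defs "Jordan_Normal_Form.Jordan_Normal_Form_Existence"
    "Jordan_Normal_Form.Jordan_Normal_Form_Uniqueness"
begin

text \<open>
  The Laplacian is symmetric, so the multiplicity \<open>m\<close> of \<open>\<mu>\<close> is the dimension of its eigenspace. Hence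
  there is a nonzero eigenfunction vanishing on any prescribed set of fewer than \<open>m\<close> vertices.

  For \<open>\<mu> \<noteq> 1\<close> an eigenfunction is determined by its restriction to the core \<open>T'\<close>, the tree without its
  leaves, and there already by its values at all but one of the \<open>q\<close> leaves of \<open>T'\<close> (the ends). So
  \<open>m \<le> q - 1\<close>. Every end carries a leaf of \<open>T\<close>, so \<open>n \<ge> 2 q + 1\<close>, and \<open>n = 2 m + 5\<close> leaves two
  possibilities: \<open>q = m + 2\<close>, with one vertex beyond the ends and one leaf at each of them, or
  \<open>q = m + 1\<close>, with three such vertices. In the second case any two ends support an eigenfunction
  that vanishes at all other ends. Such functions force \<open>T'\<close> to be a star and all its legs to satisfy
  \<open>\<mu>\<^sup>2 - 3 \<mu> + 1 = 0\<close>; in the first case \<open>T\<close> is the spider with all legs long, whose multiplicities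
  are \<open>q - 1\<close> for the two roots of this polynomial and too small otherwise.
\<close>

section \<open>Multiplicities of eigenvalues of symmetric matrices\<close>

text \<open>The quadratic comes from a leg of length two at a vertex where the eigenfunction
  vanishes: value 1 at the near vertex forces \<open>1 / (1 - \<mu>)\<close> at the far one, and the
  equation at the near vertex becomes \<open>2 - \<mu> - 1 / (1 - \<mu>) = 0\<close>. Zeros travel
  inward from an end to its neighbour, so an eigenfunction supported on two ends meets such a leg
  whenever a third end shares the attachment point. This is where \<open>n >= 9\<close> enters: it
  makes m at least 2 and the number of ends at least 3. With two or three inner vertices the leg
  condition alone is no contradiction; the equation at an inner vertex has to be combined with the
  few vertices that remain. Multiplicity is by definition a root order. It is used only through two
  facts: eigenfunctions with fewer than m prescribed zeros, which restrict the tree, and determining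
  sets of size m, which bound m from below. The algebraic connectivity is computed on the spider:
  below the smaller root of the quadratic only the simple eigenvalue 0 occurs.\<close>

lemma kernel_vector_vanishing:
  fixes A :: "'a :: field mat"
  assumes A: "A \<in> carrier_mat n n" and S: "S \<subseteq> {..<n}" and lt: "card S < kernel_dim A"
  obtains v where "v \<in> carrier_vec n" "v \<noteq> 0\<^sub>v n" "A *\<^sub>v v = 0\<^sub>v n" "\<And>s. s \<in> S \<Longrightarrow> v $ s = 0"
proof -
  define R where "R = gauss_jordan_single A"
  note gj = gauss_jordan_single[OF A R_def[symmetric]]
  have R: "R \<in> carrier_mat n n" by (rule gj(2))
  obtain p where piv: "pivot_fun R p n" using gj(3) R unfolding row_echelon_form_def by auto
  define Z where "Z = {i. i < n \<and> row R i = 0\<^sub>v n}"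
  have "kernel_dim A = n - card {i. i < n \<and> row R i \<noteq> 0\<^sub>v n}"
    using A unfolding kernel_dim_code R_def[symmetric] pivot_positions(4)[OF R piv] by auto
  moreover have "n = card Z + card {i. i < n \<and> row R i \<noteq> 0\<^sub>v n}"
  proof -
    have "{..<n} = Z \<union> {i. i < n \<and> row R i \<noteq> 0\<^sub>v n}" unfolding Z_def by auto
    then have "n = card (Z \<union> {i. i < n \<and> row R i \<noteq> 0\<^sub>v n})" by (metis card_lessThan)
    also have "\<dots> = card Z + card {i. i < n \<and> row R i \<noteq> 0\<^sub>v n}"
      by (rule card_Un_disjoint) (auto simp: Z_def)
    finally show ?thesis .
  qed
  ultimately have "card S < card Z" using lt by simp
  have finZ: "finite Z" and finS: "finite S" using S finite_subset by (auto simp: Z_def)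
  obtain Z' where Z': "Z' \<subseteq> Z" "card Z' = card S" 
    using \<open>card S < card Z\<close> by (metis less_imp_le obtain_subset_with_card_n)
  obtain z0 where z0: "z0 \<in> Z" "z0 \<notin> Z'" 
    using \<open>card S < card Z\<close> Z' by (metis less_irrefl subsetI subset_antisym)
  obtain h where h: "bij_betw h Z' S" 
    using Z' finS finite_subset[OF Z'(1) finZ] finite_same_card_bij by blast
  \<comment> \<open>The \<open>kernel_dim A\<close> zero rows of the reduced form impose nothing.
    Overwriting \<open>card S\<close> of them by the equations \<open>v $ s = 0\<close> still leaves
    a zero row, so the square matrix \<open>M\<close> is singular.\<close>
  define M where "M = mat n n (\<lambda>(i,j). if i \<in> Z' then (if j = h i then 1 else 0) else R $$ (i,j))"
  have M: "M \<in> carrier_mat n n" unfolding M_def by auto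
  have z0n: "z0 < n" using z0 by (auto simp: Z_def)
  have Mrow: "row M i = row R i" if "i < n" "i \<notin> Z'" for i
    using that R unfolding M_def by (intro eq_vecI) auto
  have "row M z0 = 0\<^sub>v n" using Mrow[OF z0n z0(2)] z0(1) by (simp add: Z_def)
  then have z0row: "\<And>j. j < n \<Longrightarrow> M $$ (z0, j) = 0"
    by (metis M carrier_matD index_row(1) index_zero_vec(1) z0n)
  have "det M = (\<Sum>j<n. M $$ (z0, j) * cofactor M z0 j)"
    by (rule laplace_expansion_row[OF M z0n])
  also have "\<dots> = 0" using z0row by simp
  finally obtain v where v: "v \<in> carrier_vec n" "v \<noteq> 0\<^sub>v n" "M *\<^sub>v v = 0\<^sub>v n"
    using det_0_iff_vec_prod_zero_field[OF M] by auto
  have Mv: "row M i \<bullet> v = 0" if "i < n" for i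
    using arg_cong[OF v(3), of "\<lambda>u. u $ i"] that M by simp
  have "R *\<^sub>v v = 0\<^sub>v n"
  proof (intro eq_vecI)
    fix i assume "i < dim_vec (0\<^sub>v n :: 'a vec)"
    then have i: "i < n" by simp
    show "(R *\<^sub>v v) $ i = 0\<^sub>v n $ i"
    proof (cases "i \<in> Z'")
      case True
      then have "row R i = 0\<^sub>v n" using Z' by (auto simp: Z_def)
      then show ?thesis using i R v(1) by simp
    next
      case False
      then show ?thesis using Mv[OF i] Mrow[OF i False] i R by simp
    qed
  qed (use R in auto)
  then have "A *\<^sub>v v = 0\<^sub>v n" using gj(1)[OF v(1)] by simp
  moreover have "v $ s = 0" if "s \<in> S" for s
  proof -
    obtain i where i: "i \<in> Z'" "h i = s" using h \<open>s \<in> S\<close> unfolding bij_betw_def by blast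
    have "i < n" "s < n" using i Z' S that by (auto simp: Z_def)
    have "row M i = unit_vec n s"
      using i \<open>i < n\<close> \<open>s < n\<close> unfolding M_def by (intro eq_vecI) auto
    then show ?thesis using Mv[OF \<open>i < n\<close>] v(1) \<open>s < n\<close> by simp
  qed
  ultimately show thesis using that v by blast
qed

text \<open>The non-pivot columns serve as \<open>S\<close>: pivot columns of the reduced form are
  unit vectors, so each pivot variable is a combination of the free ones.\<close>

lemma kernel_determining_set:
  fixes A :: "'a :: field mat"
  assumes A: "A \<in> carrier_mat n n"
  obtains S where "S \<subseteq> {..<n}" "card S = kernel_dim A"
    "\<And>v. v \<in> carrier_vec n \<Longrightarrow> A *\<^sub>v v = 0\<^sub>v n \<Longrightarrow> (\<And>s. s \<in> S \<Longrightarrow> v $ s = 0) \<Longrightarrow> v = 0\<^sub>v n"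
proof -
  define R where "R = gauss_jordan_single A"
  note gj = gauss_jordan_single[OF A R_def[symmetric]]
  have R: "R \<in> carrier_mat n n" by (rule gj(2))
  have dR: "dim_row R = n" using R by simp
  obtain p where piv: "pivot_fun R p n" using gj(3) R unfolding row_echelon_form_def by auto
  note pD = pivot_funD[OF dR piv]
  note pp = pivot_positions[OF R piv]
  define C where "C = snd ` set (pivot_positions R)"
  have C: "C = {p i | i. i < n \<and> p i \<noteq> n}" unfolding C_def pp(1) by force
  have Cn: "C \<subseteq> {..<n}" unfolding C using pD(1) by (auto simp: le_less)
  have "card C = length (pivot_positions R)"
    unfolding C_def using distinct_card[OF pp(3)] by simp
  then have "card ({..<n} - C) = kernel_dim A"
    using A Cn unfolding kernel_dim_code R_def[symmetric] 
    by (simp add: card_Diff_subset finite_subset)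
  moreover have "v = 0\<^sub>v n" if v: "v \<in> carrier_vec n" "A *\<^sub>v v = 0\<^sub>v n" 
    and van: "\<And>s. s \<in> {..<n} - C \<Longrightarrow> v $ s = 0" for v
  proof (intro eq_vecI)
    have Rv: "R *\<^sub>v v = 0\<^sub>v n" using gj(1)[OF v(1)] v(2) by simp
    fix j assume "j < dim_vec (0\<^sub>v n :: 'a vec)"
    then have j: "j < n" by simp
    show "v $ j = 0\<^sub>v n $ j"
    proof (cases "j \<in> C")
      case True
      then obtain i where i: "i < n" "p i = j" "p i \<noteq> n" unfolding C by auto
      have "0 = row R i \<bullet> v" using arg_cong[OF Rv, of "\<lambda>u. u $ i"] i R by simp
      also have "\<dots> = (\<Sum>k\<in>{0..<n}. R $$ (i,k) * v $ k)"
        unfolding scalar_prod_def using v i R by auto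
      also have "\<dots> = (\<Sum>k\<in>{j}. R $$ (i,k) * v $ k)"
      proof (rule sum.mono_neutral_right)
        show "\<forall>k\<in>{0..<n} - {j}. R $$ (i, k) * v $ k = 0"
        proof
          fix k assume k: "k \<in> {0..<n} - {j}"
          show "R $$ (i, k) * v $ k = 0"
          proof (cases "k \<in> C")
            case True
            then obtain i' where i': "i' < n" "p i' = k" "p i' \<noteq> n" unfolding C by auto
            then have "i' \<noteq> i" using k i by auto
            then have "R $$ (i, k) = 0" using pD(5)[OF i'(1) _ i(1)] i' k by auto
            then show ?thesis by simp
          next
            case False
            then show ?thesis using van[of k] k by simp
          qed
        qed
      qed (use j in auto)
      also have "\<dots> = v $ j" using pD(4)[OF i(1)] i j by simp
      finally show ?thesis using j by simp
    next
      case False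
      then show ?thesis using van j by simp
    qed
  qed (use v in auto)
  ultimately show thesis using that[of "{..<n} - C"] by blast
qed

lemma mat_mult_vec_index:
  assumes "A \<in> carrier_mat n n" "v \<in> carrier_vec n" "i < n"
  shows "(A *\<^sub>v v) $ i = (\<Sum>j<n. A $$ (i,j) * v $ j)"
  using assms by (simp add: scalar_prod_def lessThan_atLeast0)

text \<open>Self-adjointness: for \<open>w = C v\<close> the squared norm of \<open>w\<close> is
  \<open><C v, w> = <v, C w> = 0\<close>.\<close>

lemma complex_of_real_symmetric_kernel_square:
  fixes B :: "real mat"
  assumes B: "B \<in> carrier_mat n n" and sym: "\<And>i j. i < n \<Longrightarrow> j < n \<Longrightarrow> B $$ (i,j) = B $$ (j,i)"
  defines "C \<equiv> map_mat complex_of_real B"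
  assumes v: "v \<in> carrier_vec n" and CCv: "C *\<^sub>v (C *\<^sub>v v) = 0\<^sub>v n"
  shows "C *\<^sub>v v = 0\<^sub>v n"
proof -
  have C: "C \<in> carrier_mat n n" using B by (simp add: C_def)
  define w where "w = C *\<^sub>v v"
  have w: "w \<in> carrier_vec n" using C v by (simp add: w_def)
  have Cij: "C $$ (i,j) = complex_of_real (B $$ (i,j))" if "i < n" "j < n" for i j
    using that B by (simp add: C_def)
  have wi: "w $ i = (\<Sum>j<n. C $$ (i,j) * v $ j)" if "i < n" for i
    unfolding w_def by (rule mat_mult_vec_index[OF C v that])
  have Cw: "(\<Sum>i<n. C $$ (j,i) * w $ i) = 0" if "j < n" for j
    using mat_mult_vec_index[OF C w that] CCv that by (simp add: w_def)
  have "(\<Sum>i<n. w $ i * cnj (w $ i)) = (\<Sum>i<n. \<Sum>j<n. w $ i * (C $$ (i,j) * cnj (v $ j)))"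
    by (intro sum.cong refl) (simp add: wi Cij sum_distrib_left)
  also have "\<dots> = (\<Sum>j<n. \<Sum>i<n. w $ i * (C $$ (i,j) * cnj (v $ j)))" by (rule sum.swap)
  also have "\<dots> = (\<Sum>j<n. cnj (v $ j) * (\<Sum>i<n. C $$ (j,i) * w $ i))"
    by (intro sum.cong refl) (auto simp: sum_distrib_left Cij sym intro!: sum.cong)
  also have "\<dots> = 0" using Cw by simp
  finally have "(\<Sum>i<n. complex_of_real ((cmod (w $ i))\<^sup>2)) = 0" by (simp add: complex_norm_square[symmetric] mult.commute)
  then have "(\<Sum>i<n. (cmod (w $ i))\<^sup>2) = 0" by (metis of_real_eq_0_iff of_real_sum)
  then have "\<forall>i<n. w $ i = 0" by (simp add: sum_nonneg_eq_0_iff)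
  then show ?thesis using w C unfolding w_def by (intro eq_vecI) auto
qed

text \<open>Over the complex numbers a Jordan form exists; as the kernel of a Hermitian matrix equals
  the kernel of its square, all its blocks have size at most one.\<close>

lemma order_char_poly_symmetric:
  fixes A :: "real mat"
  assumes A: "A \<in> carrier_mat n n" and sym: "\<And>i j. i < n \<Longrightarrow> j < n \<Longrightarrow> A $$ (i,j) = A $$ (j,i)"
  shows "Polynomial.order x (char_poly A) = kernel_dim (map_mat complex_of_real (char_matrix A x))"
proof -
  define AC where "AC = map_mat complex_of_real A"
  define B where "B = char_matrix A x"
  define C where "C = map_mat complex_of_real B"
  have AC: "AC \<in> carrier_mat n n" using A by (simp add: AC_def)
  have B: "B \<in> carrier_mat n n" using A by (simp add: B_def)
  have C: "C \<in> carrier_mat n n" using B by (simp add: C_def)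
  have Bsym: "B $$ (i,j) = B $$ (j,i)" if "i < n" "j < n" for i j
    using that A sym[OF that] by (auto simp: B_def char_matrix_def)
  have CAC: "char_matrix AC (complex_of_real x) = C"
    using A unfolding C_def B_def AC_def char_matrix_def by (intro eq_matI) auto
  obtain as where as: "char_poly AC = (\<Prod>a\<leftarrow>as. [:- a, 1:])"
    using char_poly_factorized[OF AC] by auto
  obtain bs where bs: "jordan_nf AC bs" using jordan_nf_exists[OF AC as] ..
  let ?ns = "map fst [(n, e)\<leftarrow>bs . e = complex_of_real x]"
  have "Polynomial.order x (char_poly A) = Polynomial.order (complex_of_real x) (map_poly complex_of_real (char_poly A))"
  proof -
    interpret map_poly_inj_idom_divide_hom complex_of_real ..
    show ?thesis by (rule order_hom[symmetric])
  qed
  also have "\<dots> = Polynomial.order (complex_of_real x) (char_poly AC)"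
    unfolding AC_def of_real_hom.char_poly_hom[OF A] ..
  also have "\<dots> = sum_list ?ns" unfolding jordan_nf_order[OF bs]
    by (intro arg_cong[where f = sum_list] arg_cong[where f = "map fst"] filter_cong) auto
  finally have ord: "Polynomial.order x (char_poly A) = sum_list ?ns" .
  have "mat_kernel (C * C) = mat_kernel C"
  proof -
    have "C *\<^sub>v v = 0\<^sub>v n \<longleftrightarrow> (C * C) *\<^sub>v v = 0\<^sub>v n" if v: "v \<in> carrier_vec n" for v
    proof
      assume "C *\<^sub>v v = 0\<^sub>v n"
      moreover have "C *\<^sub>v 0\<^sub>v n = 0\<^sub>v n" using C by (intro eq_vecI) auto
      ultimately show "(C * C) *\<^sub>v v = 0\<^sub>v n" using C v by simp
    next
      assume "(C * C) *\<^sub>v v = 0\<^sub>v n"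
      then have "C *\<^sub>v (C *\<^sub>v v) = 0\<^sub>v n" using C v by simp
      then show "C *\<^sub>v v = 0\<^sub>v n"
        using complex_of_real_symmetric_kernel_square[OF B Bsym v] by (simp add: C_def)
    qed
    then show ?thesis unfolding mat_kernel[OF C] mat_kernel[OF mult_carrier_mat[OF C C]] by blast
  qed
  then have "kernel_dim (C * C) = kernel_dim C" unfolding kernel_dim_def using C by simp
  then have "dim_gen_eigenspace AC (complex_of_real x) 2 = dim_gen_eigenspace AC (complex_of_real x) 1"
    unfolding dim_gen_eigenspace_def CAC using C by (simp add: numeral_2_eq_2)
  \<comment> \<open>The kernel of the j-th power has as dimension the sum of \<open>min j\<close>
    over the block sizes, so a block of size two or more would make the sums for 1 and 2
    differ.\<close>
  then have "sum_list (map (min 2) ?ns) = sum_list (map (min 1) ?ns)"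
    unfolding dim_gen_eigenspace[OF bs] .
  moreover have "sum_list (map (min 2) ns) = sum_list (map (min 1) ns) \<Longrightarrow> sum_list ns = sum_list (map (min 1) ns)" 
    for ns :: "nat list"
  proof (induction ns)
    case (Cons a ns)
    have "sum_list (map (min 1) ns) \<le> sum_list (map (min 2) ns)" by (intro sum_list_mono) auto
    with Cons.prems have "min 2 a = min 1 a" "sum_list (map (min 2) ns) = sum_list (map (min 1) ns)" by auto
    with Cons.IH show ?case by auto
  qed simp
  ultimately have "sum_list ?ns = sum_list (map (min 1) ?ns)" by blast
  also have "\<dots> = dim_gen_eigenspace AC (complex_of_real x) 1" unfolding dim_gen_eigenspace[OF bs] ..
  also have "\<dots> = kernel_dim C" unfolding dim_gen_eigenspace_def CAC using C by simp
  finally show ?thesis unfolding ord C_def B_def .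
qed

lemma complex_char_matrix_mult_vec:
  fixes A :: "real mat"
  assumes A: "A \<in> carrier_mat n n" and v: "v \<in> carrier_vec n" and i: "i < n"
  shows "(map_mat complex_of_real (char_matrix A x) *\<^sub>v v) $ i
    = (\<Sum>j<n. complex_of_real (A $$ (i,j)) * v $ j) - complex_of_real x * v $ i"
proof -
  have "(map_mat complex_of_real (char_matrix A x) *\<^sub>v v) $ i
    = (\<Sum>j<n. complex_of_real (char_matrix A x $$ (i,j)) * v $ j)"
    using A v i by (subst mat_mult_vec_index[of _ n]) (auto simp: char_matrix_def)
  also have "\<dots> = (\<Sum>j<n. complex_of_real (A $$ (i,j)) * v $ j
      - (if j = i then complex_of_real x * v $ i else 0))"
    using A i by (intro sum.cong refl) (auto simp: char_matrix_def algebra_simps)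
  also have "\<dots> = (\<Sum>j<n. complex_of_real (A $$ (i,j)) * v $ j) - complex_of_real x * v $ i"
    using i by (simp add: sum_subtractf)
  finally show ?thesis .
qed

lemma symmetric_eigenvector_vanishing:
  fixes A :: "real mat"
  assumes A: "A \<in> carrier_mat n n" and sym: "\<And>i j. i < n \<Longrightarrow> j < n \<Longrightarrow> A $$ (i,j) = A $$ (j,i)"
    and S: "S \<subseteq> {..<n}" "card S < Polynomial.order x (char_poly A)"
  obtains f where "\<And>i. i < n \<Longrightarrow> (\<Sum>j<n. A $$ (i,j) * f j) = x * f i" "\<exists>i<n. f i \<noteq> 0"
    "\<And>s. s \<in> S \<Longrightarrow> f s = 0"
proof -
  define C where "C = map_mat complex_of_real (char_matrix A x)"
  have C: "C \<in> carrier_mat n n" using A by (simp add: C_def)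
  have "card S < kernel_dim C" using S(2) order_char_poly_symmetric[OF A sym] by (simp add: C_def)
  then obtain v where v: "v \<in> carrier_vec n" "v \<noteq> 0\<^sub>v n" "C *\<^sub>v v = 0\<^sub>v n" "\<And>s. s \<in> S \<Longrightarrow> v $ s = 0"
    using kernel_vector_vanishing[OF C S(1)] by blast
  have eq: "(\<Sum>j<n. complex_of_real (A $$ (i,j)) * v $ j) = complex_of_real x * v $ i" if "i < n" for i
    using complex_char_matrix_mult_vec[OF A v(1) that, of x] v(3) that by (simp add: C_def)
  \<comment> \<open>\<open>A\<close> and \<open>x\<close> are real, so the real and imaginary parts
    of the complex kernel vector are eigenfunctions with the prescribed zeros, and one of them is
    nonzero.\<close>
  have re: "(\<Sum>j<n. A $$ (i,j) * Re (v $ j)) = x * Re (v $ i)" if "i < n" for i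
    using arg_cong[OF eq[OF that], of Re] by simp
  have im: "(\<Sum>j<n. A $$ (i,j) * Im (v $ j)) = x * Im (v $ i)" if "i < n" for i
    using arg_cong[OF eq[OF that], of Im] by simp
  obtain i where i: "i < n" "v $ i \<noteq> 0" using v(1,2) by (metis carrier_vecD eq_vecI index_zero_vec)
  show thesis
  proof (cases "Re (v $ i) = 0")
    case True
    then have "Im (v $ i) \<noteq> 0" using i by (simp add: complex_eq_iff)
    then show thesis using that[of "\<lambda>j. Im (v $ j)"] im i v(4) by auto
  next
    case False
    then show thesis using that[of "\<lambda>j. Re (v $ j)"] re i v(4) by auto
  qed
qed

text \<open>Source of lower bounds: the multiplicity exceeds r as soon as every set of at most r
  indices lies in the zero set of some nonzero eigenvector.\<close>

lemma symmetric_determining_set: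
  fixes A :: "real mat"
  assumes A: "A \<in> carrier_mat n n" and sym: "\<And>i j. i < n \<Longrightarrow> j < n \<Longrightarrow> A $$ (i,j) = A $$ (j,i)"
  obtains S where "S \<subseteq> {..<n}" "card S = Polynomial.order x (char_poly A)"
    "\<And>f i. (\<And>i. i < n \<Longrightarrow> (\<Sum>j<n. A $$ (i,j) * f j) = x * f i) \<Longrightarrow> (\<And>s. s \<in> S \<Longrightarrow> f s = 0)
      \<Longrightarrow> i < n \<Longrightarrow> f i = 0"
proof -
  define C where "C = map_mat complex_of_real (char_matrix A x)"
  have C: "C \<in> carrier_mat n n" using A by (simp add: C_def)
  obtain S where S: "S \<subseteq> {..<n}" "card S = kernel_dim C" and det:
    "\<And>v. v \<in> carrier_vec n \<Longrightarrow> C *\<^sub>v v = 0\<^sub>v n \<Longrightarrow> (\<And>s. s \<in> S \<Longrightarrow> v $ s = 0) \<Longrightarrow> v = 0\<^sub>v n"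
    using kernel_determining_set[OF C] by blast
  show thesis
  proof (rule that[OF S(1)])
    show "card S = Polynomial.order x (char_poly A)"
      using S(2) order_char_poly_symmetric[OF A sym] by (simp add: C_def)
    fix f i
    assume f: "\<And>i. i < n \<Longrightarrow> (\<Sum>j<n. A $$ (i,j) * f j) = x * f i" and van: "\<And>s. s \<in> S \<Longrightarrow> f s = 0"
      and i: "i < n"
    define v where "v = vec n (\<lambda>j. complex_of_real (f j))"
    have v: "v \<in> carrier_vec n" by (simp add: v_def)
    have "C *\<^sub>v v = 0\<^sub>v n"
    proof (rule eq_vecI)
      fix i assume "i < dim_vec (0\<^sub>v n :: complex vec)"
      then have i: "i < n" by simp
      have "(\<Sum>j<n. complex_of_real (A $$ (i,j)) * v $ j) = (\<Sum>j<n. complex_of_real (A $$ (i,j) * f j))"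
        by (intro sum.cong refl) (simp add: v_def)
      also have "\<dots> = complex_of_real (x * f i)" using f[OF i] by (metis of_real_sum)
      finally show "(C *\<^sub>v v) $ i = 0\<^sub>v n $ i"
        using complex_char_matrix_mult_vec[OF A v i, of x] i by (simp add: C_def v_def)
    qed (use C in auto)
    moreover have "v $ s = 0" if "s \<in> S" for s
      using van[OF that] that S(1) by (auto simp: v_def)
    ultimately have "v = 0\<^sub>v n" using det v by blast
    then have "v $ i = 0" using i by simp
    then show "f i = 0" using i by (simp add: v_def)
  qed
qed

section \<open>Laplacian eigenfunctions\<close>

text \<open>A function on all naturals of which only the values below \<open>n\<close> matter; it
  can be composed with an isomorphism or defined by cases without vector dimensions.\<close>

definition lap_eigfun :: "nat \<Rightarrow> (nat \<Rightarrow> nat \<Rightarrow> bool) \<Rightarrow> real \<Rightarrow> (nat \<Rightarrow> real) \<Rightarrow> bool" where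
  "lap_eigfun n E \<mu> f \<longleftrightarrow>
    (\<forall>i<n. real (degree n E i) * f i - (\<Sum>j | j < n \<and> E i j. f j) = \<mu> * f i)"

lemma laplacian_carrier[simp]: "laplacian n E \<in> carrier_mat n n"
  by (simp add: laplacian_def)

lemma laplacian_row_sum:
  fixes f :: "nat \<Rightarrow> real"
  assumes "simple_graph n E" "i < n"
  shows "(\<Sum>j<n. laplacian n E $$ (i,j) * f j) = real (degree n E i) * f i - (\<Sum>j | j < n \<and> E i j. f j)"
proof -
  have irr: "\<not> E i i" using assms(1) by (auto simp: simple_graph_def)
  have "(\<Sum>j<n. laplacian n E $$ (i,j) * f j) =
    (\<Sum>j<n. (if j = i then real (degree n E i) * f i else 0) - (if E i j then f j else 0))"
    using assms(2) irr by (intro sum.cong refl) (auto simp: laplacian_def)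
  also have "\<dots> = real (degree n E i) * f i - (\<Sum>j<n. if E i j then f j else 0)"
    using assms(2) by (simp add: sum_subtractf)
  also have "(\<Sum>j<n. if E i j then f j else 0) = (\<Sum>j | j < n \<and> E i j. f j)"
    by (subst sum.inter_filter[symmetric]) auto
  finally show ?thesis .
qed

lemma laplacian_symmetric:
  assumes "simple_graph n E" "i < n" "j < n"
  shows "laplacian n E $$ (i,j) = laplacian n E $$ (j,i)"
  using assms by (auto simp: laplacian_def simple_graph_def)

lemma eigfun_vanishing:
  assumes "simple_graph n E" "S \<subseteq> {..<n}" "card S < lap_mult n E \<mu>"
  obtains f where "lap_eigfun n E \<mu> f" "\<exists>i<n. f i \<noteq> 0" "\<And>s. s \<in> S \<Longrightarrow> f s = 0"
proof -
  obtain f where "\<And>i. i < n \<Longrightarrow> (\<Sum>j<n. laplacian n E $$ (i,j) * f j) = \<mu> * f i" "\<exists>i<n. f i \<noteq> 0"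
    "\<And>s. s \<in> S \<Longrightarrow> f s = 0"
    using symmetric_eigenvector_vanishing[OF laplacian_carrier laplacian_symmetric[OF assms(1)] assms(2)]
      assms(3) unfolding lap_mult_def by blast
  then show thesis using that laplacian_row_sum[OF assms(1)] unfolding lap_eigfun_def by auto
qed

lemma eigfun_determining_set:
  assumes "simple_graph n E"
  obtains S where "S \<subseteq> {..<n}" "card S = lap_mult n E \<mu>"
    "\<And>f i. lap_eigfun n E \<mu> f \<Longrightarrow> (\<And>s. s \<in> S \<Longrightarrow> f s = 0) \<Longrightarrow> i < n \<Longrightarrow> f i = 0"
proof (rule symmetric_determining_set[OF laplacian_carrier laplacian_symmetric[OF assms]])
  fix S
  assume S: "S \<subseteq> {..<n}" "card S = Polynomial.order \<mu> (char_poly (laplacian n E))"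
    "\<And>f i. (\<And>i. i < n \<Longrightarrow> (\<Sum>j<n. laplacian n E $$ (i,j) * f j) = \<mu> * f i) \<Longrightarrow> (\<And>s. s \<in> S \<Longrightarrow> f s = 0)
      \<Longrightarrow> i < n \<Longrightarrow> f i = 0"
  show thesis
  proof (rule that[OF S(1)])
    show "card S = lap_mult n E \<mu>" using S(2) by (simp add: lap_mult_def)
    show "f i = 0" if "lap_eigfun n E \<mu> f" "\<And>s. s \<in> S \<Longrightarrow> f s = 0" "i < n" for f i
      by (rule S(3)[OF _ that(2,3)])
        (use that(1) laplacian_row_sum[OF assms, of _ f] in \<open>auto simp: lap_eigfun_def\<close>)
  qed
qed

section \<open>Invariance under graph isomorphism\<close>

lemma graph_iso_sym: "graph_iso n E m F \<Longrightarrow> graph_iso m F n E"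
  unfolding graph_iso_def
proof (elim exE conjE)
  fix f assume f: "bij_betw f {0..<n} {0..<m}" "\<forall>i<n. \<forall>j<n. E i j = F (f i) (f j)"
  let ?g = "inv_into {0..<n} f"
  have g: "bij_betw ?g {0..<m} {0..<n}" using f(1) by (rule bij_betw_inv_into)
  have "F i j = E (?g i) (?g j)" if "i < m" "j < m" for i j
  proof -
    have "?g i < n" "?g j < n" using bij_betwE[OF g] that by auto
    moreover have "f (?g i) = i" "f (?g j) = j" using bij_betw_inv_into_right[OF f(1)] that by auto
    ultimately show ?thesis using f(2) by auto
  qed
  with g show "\<exists>g. bij_betw g {0..<m} {0..<n} \<and> (\<forall>i<m. \<forall>j<m. F i j = E (g i) (g j))" by blast
qed

lemma lap_eigfun_iso:
  assumes f: "bij_betw f {0..<n} {0..<m}" "\<And>i j. i < n \<Longrightarrow> j < n \<Longrightarrow> E i j = F (f i) (f j)"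
    and g: "lap_eigfun m F \<mu> g"
  shows "lap_eigfun n E \<mu> (g \<circ> f)"
  unfolding lap_eigfun_def
proof (intro allI impI)
  fix i assume i: "i < n"
  then have fi: "f i < m" using bij_betwE[OF f(1)] by auto
  have inj: "inj_on f {0..<n}" and im: "f ` {0..<n} = {0..<m}" using f(1) by (auto simp: bij_betw_def)
  have nb: "{j. j < m \<and> F (f i) j} = f ` {j. j < n \<and> E i j}"
  proof
    show "{j. j < m \<and> F (f i) j} \<subseteq> f ` {j. j < n \<and> E i j}"
    proof
      fix k assume k: "k \<in> {j. j < m \<and> F (f i) j}"
      then obtain j where "j < n" "f j = k" using im by (metis (mono_tags, lifting) atLeastLessThan_iff imageE mem_Collect_eq zero_le)
      then show "k \<in> f ` {j. j < n \<and> E i j}" using k f(2)[OF i] by auto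
    qed
    show "f ` {j. j < n \<and> E i j} \<subseteq> {j. j < m \<and> F (f i) j}"
      using f(2)[OF i] im by force
  qed
  have inj': "inj_on f {j. j < n \<and> E i j}" by (rule inj_on_subset[OF inj]) auto
  have "degree n E i = degree m F (f i)" unfolding degree_def nb by (simp add: card_image[OF inj'])
  moreover have "(\<Sum>j | j < m \<and> F (f i) j. g j) = (\<Sum>j | j < n \<and> E i j. (g \<circ> f) j)"
    unfolding nb by (simp add: sum.reindex[OF inj'])
  ultimately show "real (degree n E i) * (g \<circ> f) i - (\<Sum>j | j < n \<and> E i j. (g \<circ> f) j) = \<mu> * (g \<circ> f) i"
    using g fi unfolding lap_eigfun_def by auto
qed

text \<open>If the multiplicity on \<open>F\<close> were larger, some nonzero eigenfunction of
  \<open>F\<close> would vanish on the image of a determining set of \<open>E\<close>; its pullback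
  would then be zero.\<close>

lemma lap_mult_iso_le:
  assumes "simple_graph n E" "simple_graph m F" "graph_iso n E m F"
  shows "lap_mult m F \<mu> \<le> lap_mult n E \<mu>"
proof (rule ccontr)
  assume "\<not> lap_mult m F \<mu> \<le> lap_mult n E \<mu>"
  then have lt: "lap_mult n E \<mu> < lap_mult m F \<mu>" by simp
  obtain f where f: "bij_betw f {0..<n} {0..<m}" "\<And>i j. i < n \<Longrightarrow> j < n \<Longrightarrow> E i j = F (f i) (f j)"
    using assms(3) unfolding graph_iso_def by auto
  obtain S where S: "S \<subseteq> {..<n}" "card S = lap_mult n E \<mu>"
    "\<And>g i. lap_eigfun n E \<mu> g \<Longrightarrow> (\<And>s. s \<in> S \<Longrightarrow> g s = 0) \<Longrightarrow> i < n \<Longrightarrow> g i = 0"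
    using eigfun_determining_set[OF assms(1)] by blast
  have "card (f ` S) < lap_mult m F \<mu>"
    using lt S(2) card_image_le[OF finite_subset[OF S(1) finite_lessThan], of f] by simp
  moreover have "f ` S \<subseteq> {..<m}" using bij_betwE[OF f(1)] S(1) by auto
  ultimately obtain g where g: "lap_eigfun m F \<mu> g" "\<exists>i<m. g i \<noteq> 0" "\<And>s. s \<in> f ` S \<Longrightarrow> g s = 0"
    using eigfun_vanishing[OF assms(2)] by blast
  have "(g \<circ> f) i = 0" if "i < n" for i
    by (rule S(3)[OF lap_eigfun_iso[OF f g(1)] _ that]) (use g(3) in auto)
  moreover obtain k where "k < m" "g k \<noteq> 0" using g(2) by auto
  moreover then obtain i where "i < n" "f i = k"
    using f(1) unfolding bij_betw_def by (metis atLeastLessThan_iff imageE zero_le)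
  ultimately show False by auto
qed

lemma lap_mult_iso:
  assumes "simple_graph n E" "simple_graph m F" "graph_iso n E m F"
  shows "lap_mult n E \<mu> = lap_mult m F \<mu>"
  by (intro antisym lap_mult_iso_le[OF assms] lap_mult_iso_le[OF assms(2,1) graph_iso_sym[OF assms(3)]])

text \<open>The sorted spectrum depends only on the multiplicity of each real root, so
  \<open>lap_mult_iso\<close> at all reals suffices.\<close>

lemma alg_conn_iso:
  assumes "simple_graph n E" "simple_graph m F" "graph_iso n E m F"
  shows "alg_conn n E = alg_conn m F"
proof -
  have "char_poly (laplacian n E :: real mat) \<noteq> 0" for n E
    by (metis coeff_0 degree_monic_char_poly laplacian_carrier zero_neq_one)
  then have "proots (char_poly (laplacian n E :: real mat)) = proots (char_poly (laplacian m F :: real mat))"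
    using lap_mult_iso[OF assms] by (intro multiset_eqI) (simp add: lap_mult_def)
  then show ?thesis unfolding alg_conn_def lap_spectrum_def by simp
qed

section \<open>Reduction to the core of a graph\<close>

text \<open>\<open>no_leaf_edge\<close> rules out components that are a single edge, so that every
  leaf hangs from a core vertex. Being a tree is left to \<open>tree_eigenvalue\<close>; spiders
  become instances by a check of degrees.\<close>

locale core_graph =
  fixes n :: nat and E :: "nat \<Rightarrow> nat \<Rightarrow> bool" and \<mu> :: real
  assumes simple: "simple_graph n E" and mu1: "\<mu> \<noteq> 1"
    and no_leaf_edge: "\<And>v w. E v w \<Longrightarrow> degree n E v = 1 \<Longrightarrow> degree n E w \<noteq> 1"
begin

definition core :: "nat set" where "core = {v. v < n \<and> degree n E v \<noteq> 1}"
definition leaves :: "nat set" where "leaves = {v. v < n \<and> degree n E v = 1}"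
definition cn :: "nat \<Rightarrow> nat set" where "cn v = {w \<in> core. E v w}"
definition pn :: "nat \<Rightarrow> nat set" where "pn v = {w \<in> leaves. E v w}"
definition stem :: "nat \<Rightarrow> nat" where "stem v = (THE w. E v w)"

lemma edgeD: "E v w \<Longrightarrow> v < n" "E v w \<Longrightarrow> w < n" "E v w \<Longrightarrow> v \<noteq> w" "E v w \<Longrightarrow> E w v"
  using simple by (auto simp: simple_graph_def)

lemma finite_sets[simp]: "finite core" "finite leaves" "finite (cn v)" "finite (pn v)"
  by (auto simp: core_def leaves_def cn_def pn_def)

lemma core_Un_leaves: "core \<union> leaves = {..<n}" and core_Int_leaves: "core \<inter> leaves = {}"
  by (auto simp: core_def leaves_def)

lemma cn_sym: "v \<in> core \<Longrightarrow> w \<in> cn v \<Longrightarrow> v \<in> cn w"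
  by (auto simp: cn_def dest: edgeD)

lemma cn_core: "w \<in> cn v \<Longrightarrow> w \<in> core"
  by (auto simp: cn_def)

lemma cn_irrefl: "v \<notin> cn v"
  by (auto simp: cn_def dest: edgeD)

lemma neighbours_split: "{w. w < n \<and> E v w} = cn v \<union> pn v" "cn v \<inter> pn v = {}"
  by (auto simp: cn_def pn_def core_def leaves_def)

lemma degree_split: "degree n E v = card (cn v) + card (pn v)"
  unfolding degree_def neighbours_split(1) by (rule card_Un_disjoint) (auto simp: neighbours_split(2))

lemma leaf_unique: "v \<in> leaves \<Longrightarrow> \<exists>!w. E v w"
proof -
  assume "v \<in> leaves"
  then obtain w where "{w. w < n \<and> E v w} = {w}"
    unfolding leaves_def degree_def by (auto simp: card_1_singleton_iff)
  then have "E v x \<longleftrightarrow> x = w" for x using edgeD(2)[of v x] by auto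
  then show ?thesis by simp
qed

lemma stem_eq: "v \<in> leaves \<Longrightarrow> E v w \<longleftrightarrow> w = stem v"
  unfolding stem_def using leaf_unique[of v] theI'[of "E v"] by metis

lemma stem_core: "v \<in> leaves \<Longrightarrow> stem v \<in> core"
  using stem_eq[of v "stem v"] no_leaf_edge[of v "stem v"] edgeD(2)[of v "stem v"]
  by (auto simp: leaves_def core_def)

lemma mem_pn_iff: "l \<in> pn v \<longleftrightarrow> l \<in> leaves \<and> stem l = v"
  using stem_eq[of l v] edgeD(4)[of v l] edgeD(4)[of l v] by (auto simp: pn_def)

lemma card_leaves: "card leaves = (\<Sum>v\<in>core. card (pn v))"
proof -
  have "leaves = (\<Union>v\<in>core. pn v)" using stem_core by (auto simp: mem_pn_iff)
  moreover have "card (\<Union>v\<in>core. pn v) = (\<Sum>v\<in>core. card (pn v))"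
    by (rule card_UN_disjoint) (auto simp: mem_pn_iff)
  ultimately show ?thesis by metis
qed

text \<open>The diagonal coefficient at a core vertex \<open>v\<close> with \<open>d\<close> core neighbours and \<open>a\<close> leaves, after the
  values \<open>f v / (1 - \<mu>)\<close> at the leaves have been eliminated from the eigenvalue equation.\<close>

definition leg_coeff :: "nat \<Rightarrow> nat \<Rightarrow> real" where
  "leg_coeff d a = real d + real a - \<mu> - real a / (1 - \<mu>)"

lemma eigfun_iff:
  "lap_eigfun n E \<mu> f \<longleftrightarrow> (\<forall>l\<in>leaves. f (stem l) = (1 - \<mu>) * f l) \<and>
    (\<forall>v\<in>core. leg_coeff (card (cn v)) (card (pn v)) * f v = (\<Sum>w\<in>cn v. f w))"
proof -
  let ?eq = "\<lambda>v. real (degree n E v) * f v - (\<Sum>j | j < n \<and> E v j. f j) = \<mu> * f v"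
  have leaf: "?eq l \<longleftrightarrow> f (stem l) = (1 - \<mu>) * f l" if l: "l \<in> leaves" for l
  proof -
    have "{j. j < n \<and> E l j} = {stem l}" using stem_eq[OF l] stem_core[OF l] by (auto simp: core_def)
    moreover have "degree n E l = 1" using l by (simp add: leaves_def)
    ultimately have "?eq l \<longleftrightarrow> f l - f (stem l) = \<mu> * f l" by simp
    then show ?thesis by (auto simp: left_diff_distrib)
  qed
  have inner: "?eq v \<longleftrightarrow> leg_coeff (card (cn v)) (card (pn v)) * f v = (\<Sum>w\<in>cn v. f w)"
    if leaf: "\<forall>l\<in>leaves. f (stem l) = (1 - \<mu>) * f l" for v
  proof -
    have "f l = f v / (1 - \<mu>)" if "l \<in> pn v" for l
      using leaf that mu1 by (auto simp: mem_pn_iff field_simps)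
    then have "(\<Sum>w\<in>pn v. f w) = real (card (pn v)) * (f v / (1 - \<mu>))" by simp
    moreover have "(\<Sum>j | j < n \<and> E v j. f j) = (\<Sum>w\<in>cn v. f w) + (\<Sum>w\<in>pn v. f w)"
      unfolding neighbours_split(1) by (rule sum.union_disjoint) (auto simp: neighbours_split(2))
    ultimately show ?thesis unfolding degree_split leg_coeff_def
      by (auto simp: left_diff_distrib distrib_right)
  qed
  have "lap_eigfun n E \<mu> f \<longleftrightarrow> (\<forall>v\<in>leaves. ?eq v) \<and> (\<forall>v\<in>core. ?eq v)"
    unfolding lap_eigfun_def using core_Un_leaves by auto
  then show ?thesis using leaf inner by blast
qed

lemma core_eq:
  "lap_eigfun n E \<mu> f \<Longrightarrow> v \<in> core \<Longrightarrow>
    leg_coeff (card (cn v)) (card (pn v)) * f v = (\<Sum>w\<in>cn v. f w)"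
  by (simp add: eigfun_iff)

lemma eigfun_zero_if_core_zero:
  assumes "lap_eigfun n E \<mu> f" "\<And>v. v \<in> core \<Longrightarrow> f v = 0" "i < n"
  shows "f i = 0"
proof (cases "i \<in> core")
  case False
  then have i: "i \<in> leaves" using core_Un_leaves assms(3) by auto
  then have "f (stem i) = (1 - \<mu>) * f i" using assms(1) by (simp add: eigfun_iff)
  then show ?thesis using assms(2)[OF stem_core[OF i]] mu1 by simp
qed (rule assms(2))

text \<open>Converse of the elimination: the leaf equations serve as definition of the values at the
  leaves.\<close>

lemma eigfun_extend:
  assumes "\<And>v. v \<in> core \<Longrightarrow> leg_coeff (card (cn v)) (card (pn v)) * h v = (\<Sum>w\<in>cn v. h w)"
  shows "lap_eigfun n E \<mu> (\<lambda>v. if v \<in> core then h v else h (stem v) / (1 - \<mu>))"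
proof -
  have "(\<Sum>w\<in>cn v. if w \<in> core then h w else h (stem w) / (1 - \<mu>)) = (\<Sum>w\<in>cn v. h w)" for v
    by (intro sum.cong) (auto dest: cn_core)
  then show ?thesis unfolding eigfun_iff using assms stem_core core_Int_leaves mu1 by auto
qed

text \<open>\<open>leg_coeff 1 a\<close> is affine in \<open>a\<close> with slope
  \<open>1 - 1 / (1 - \<mu>)\<close>. The slope is zero only for \<open>\<mu> = 0\<close>, where the
  coefficient is constantly 1.\<close>

lemma leg_coeff_zero_inj:
  assumes "leg_coeff 1 a = 0" "leg_coeff 1 b = 0"
  shows "a = b"
proof -
  have "\<mu> \<noteq> 0" using assms(1) by (auto simp: leg_coeff_def)
  have "(real a - real b) * (1 - 1 / (1 - \<mu>)) = 0" 
    using assms unfolding leg_coeff_def by (simp add: left_diff_distrib right_diff_distrib diff_divide_distrib)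
  moreover have "1 - 1 / (1 - \<mu>) \<noteq> 0" using \<open>\<mu> \<noteq> 0\<close> mu1 by (simp add: field_simps)
  ultimately have "real a - real b = 0" by (metis mult_eq_0_iff)
  then show ?thesis by simp
qed

text \<open>Origin of the two extremal eigenvalues: the condition is
  \<open>(2 - \<mu>) * (1 - \<mu>) = 1\<close>.\<close>

lemma leg_coeff_1_1_zero_iff: "leg_coeff 1 1 = 0 \<longleftrightarrow> \<mu>\<^sup>2 - 3 * \<mu> + 1 = 0"
  using mu1 by (simp add: leg_coeff_def field_simps power2_eq_square)

text \<open>Two legs of length two at \<open>c\<close> that avoid a determining set carry an antisymmetric eigenfunction.\<close>

lemma card_legs_le:
  assumes U: "U \<subseteq> core" and c: "c \<in> core"
    and leg: "\<And>u. u \<in> U \<Longrightarrow> cn u = {c}" "\<And>u. u \<in> U \<Longrightarrow> card (pn u) = 1" and zero: "leg_coeff 1 1 = 0"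
  shows "card U \<le> lap_mult n E \<mu> + 1"
proof (rule ccontr)
  assume "\<not> card U \<le> lap_mult n E \<mu> + 1"
  obtain S where S: "S \<subseteq> {..<n}" "card S = lap_mult n E \<mu>"
    and det: "\<And>f i. lap_eigfun n E \<mu> f \<Longrightarrow> (\<And>s. s \<in> S \<Longrightarrow> f s = 0) \<Longrightarrow> i < n \<Longrightarrow> f i = 0"
    using eigfun_determining_set[OF simple] by blast
  define own where "own s = (if s \<in> core then s else stem s)" for s
  have finU: "finite U" by (rule finite_subset[OF U]) simp
  have finS: "finite S" by (rule finite_subset[OF S(1)]) simp
  have "card U - card (own ` S) \<le> card (U - own ` S)" by (rule diff_card_le_card_Diff) (simp add: finS)
  moreover have "card (own ` S) \<le> lap_mult n E \<mu>" using card_image_le[OF finS, of own] S(2) by simp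
  ultimately have "1 < card (U - own ` S)"
    using \<open>\<not> card U \<le> lap_mult n E \<mu> + 1\<close> by linarith
  then have "\<not> (\<forall>u1\<in>U - own ` S. \<forall>u2\<in>U - own ` S. u1 = u2)"
    using card_le_Suc0_iff_eq[OF finite_Diff[OF finU, of "own ` S"]] by simp
  then obtain u1 u2 where u: "u1 \<in> U - own ` S" "u2 \<in> U - own ` S" "u1 \<noteq> u2" by blast
  define h where "h v = (if v = u1 then 1 else if v = u2 then -1 else 0 :: real)" for v
  define f where "f = (\<lambda>v. if v \<in> core then h v else h (stem v) / (1 - \<mu>))"
  have sum_h: "(\<Sum>w\<in>cn v. h w) = (if u1 \<in> cn v then 1 else 0) - (if u2 \<in> cn v then 1 else 0)" for v
  proof -
    have "(\<Sum>w\<in>cn v. h w) = (\<Sum>w\<in>cn v. (if w = u1 then 1 else 0) - (if w = u2 then 1 else 0))"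
      by (intro sum.cong) (auto simp: h_def u(3))
    then show ?thesis by (simp add: sum_subtractf)
  qed
  have mem: "w \<in> cn v \<longleftrightarrow> v = c" if "v \<in> core" "w \<in> U" for v w
    using cn_sym[of v w] cn_sym[of w c] leg(1)[OF that(2)] that U by auto
  have "lap_eigfun n E \<mu> f"
    unfolding f_def
  proof (rule eigfun_extend)
    fix v assume v: "v \<in> core"
    have "(\<Sum>w\<in>cn v. h w) = 0" using mem[OF v] u by (simp add: sum_h)
    moreover have "leg_coeff (card (cn v)) (card (pn v)) * h v = 0"
    proof (cases "v = u1 \<or> v = u2")
      case True
      then have "v \<in> U" using u by auto
      then show ?thesis using leg zero by simp
    qed (simp add: h_def)
    ultimately show "leg_coeff (card (cn v)) (card (pn v)) * h v = (\<Sum>w\<in>cn v. h w)" by simp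
  qed
  moreover have "f s = 0" if "s \<in> S" for s
  proof -
    have "own s \<noteq> u1" "own s \<noteq> u2" using that u by auto
    then show ?thesis by (auto simp: f_def h_def own_def split: if_splits)
  qed
  moreover have "u1 \<in> core" using u U by auto
  ultimately have "f u1 = 0" using det[of f u1] by (simp add: core_def)
  then show False using \<open>u1 \<in> core\<close> by (simp add: f_def h_def)
qed

end

section \<open>Eigenfunctions on trees\<close>

text \<open>The last vertex of a longest path from \<open>a\<close> has a second neighbour, which by
  maximality lies on the path and closes a cycle. Exempting \<open>a\<close> from the degree
  condition leaves room for one vertex of degree one.\<close>

lemma exists_cycle:
  assumes sg: "simple_graph n H" and ab: "H a b"
    and deg: "\<And>v w. H v w \<Longrightarrow> v \<noteq> a \<Longrightarrow> \<exists>w'. w' \<noteq> w \<and> H v w'"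
  shows "\<exists>vs. is_cycle n H vs"
proof -
  define pth where "pth xs \<longleftrightarrow> distinct xs \<and> set xs \<subseteq> {0..<n} \<and> length xs \<ge> 2 \<and> xs ! 0 = a
    \<and> (\<forall>i. Suc i < length xs \<longrightarrow> H (xs ! i) (xs ! Suc i))" for xs
  have dom: "v < n" "w < n" "v \<noteq> w" "H w v" if "H v w" for v w
    using sg that by (auto simp: simple_graph_def)
  have "pth [a, b]" using dom[OF ab] ab by (auto simp: pth_def)
  moreover have "length xs < Suc n" if "pth xs" for xs
    using that card_mono[of "{0..<n}" "set xs"] by (simp add: pth_def distinct_card)
  ultimately obtain xs where xs: "pth xs" and max: "\<And>ys. pth ys \<Longrightarrow> length ys \<le> length xs"
    using ex_has_greatest_nat[of pth "[a,b]" length "Suc n"] by metis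
  define L where "L = length xs"
  have L2: "2 \<le> L" using xs by (simp add: pth_def L_def)
  have dist: "distinct xs" and sub: "set xs \<subseteq> {0..<n}" and x0: "xs ! 0 = a"
    and step: "\<And>i. Suc i < L \<Longrightarrow> H (xs ! i) (xs ! Suc i)" using xs by (auto simp: pth_def L_def)
  define v w where "v = xs ! (L - 1)" and "w = xs ! (L - 2)"
  have "H w v" using step[of "L - 2"] L2 by (simp add: v_def w_def Suc_diff_Suc numeral_2_eq_2)
  have "v \<noteq> a" using nth_eq_iff_index_eq[OF dist, of "L - 1" 0] L2 x0 unfolding v_def L_def by linarith
  then obtain w' where w': "w' \<noteq> w" "H v w'" using deg dom(4)[OF \<open>H w v\<close>] by blast
  have "w' \<in> set xs"
  proof (rule ccontr)
    assume "w' \<notin> set xs"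
    have "H ((xs @ [w']) ! i) ((xs @ [w']) ! Suc i)" if "Suc i < Suc L" for i
    proof (cases "Suc i < L")
      case True
      then show ?thesis using step[OF True] by (simp add: nth_append L_def)
    next
      case False
      then have "i = L - 1" "Suc i = L" using that L2 by auto
      then show ?thesis using w'(2) L2 by (auto simp: nth_append L_def v_def)
    qed
    then have "pth (xs @ [w'])"
      using xs \<open>w' \<notin> set xs\<close> dom(2)[OF w'(2)] by (auto simp: pth_def nth_append L_def)
    then show False using max by fastforce
  qed
  then obtain k where k: "k < L" "xs ! k = w'" by (auto simp: in_set_conv_nth L_def)
  have "k \<noteq> L - 1" using k dom(3)[OF w'(2)] by (auto simp: v_def)
  moreover have "k \<noteq> L - 2" using k w' by (auto simp: w_def)
  ultimately have k3: "k + 3 \<le> L" using k by linarith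
  have "is_cycle n H (drop k xs)"
    unfolding is_cycle_def
  proof (intro conjI allI impI)
    show "3 \<le> length (drop k xs)" using k3 by (simp add: L_def)
    show "distinct (drop k xs)" using dist by simp
    show "set (drop k xs) \<subseteq> {0..<n}" using sub set_drop_subset[of k xs] by blast
    show "H (drop k xs ! i) (drop k xs ! Suc i)" if "Suc i < length (drop k xs)" for i
      using that step[of "k + i"] by (simp add: L_def)
    have "last (drop k xs) = v" using k3 L2 by (simp add: v_def L_def last_conv_nth)
    moreover have "hd (drop k xs) = w'" using k by (simp add: hd_drop_conv_nth L_def)
    ultimately show "H (last (drop k xs)) (hd (drop k xs))" using w' by simp
  qed
  then show ?thesis by blast
qed

lemma connected_closed:
  assumes "connected_graph n E" "v \<in> X" "v < n" "\<And>x y. x \<in> X \<Longrightarrow> E x y \<Longrightarrow> y \<in> X"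
  shows "{..<n} \<subseteq> X"
proof
  fix i assume "i \<in> {..<n}"
  then have "E\<^sup>*\<^sup>* v i" using assms(1,3) by (auto simp: connected_graph_def)
  then show "i \<in> X" by (induction rule: rtranclp_induct) (use assms(2,4) in auto)
qed

text \<open>Two adjacent leaves form a component of their own, hence the whole tree, which is too
  small.\<close>

lemma tree_core_graph:
  assumes tree: "is_tree n E" and "3 \<le> n" "\<mu> \<noteq> 1"
  shows "core_graph n E \<mu>"
proof
  show sg: "simple_graph n E" using tree by (simp add: is_tree_def)
  show "degree n E w \<noteq> 1" if "E v w" "degree n E v = 1" for v w
  proof
    assume "degree n E w = 1"
    have vw: "v < n" "w < n" "E w v" using sg that by (auto simp: simple_graph_def)
    have only: "y = z" if "degree n E x = 1" "E x y" "E x z" for x y z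
    proof -
      have "card {j. j < n \<and> E x j} = 1" using that(1) by (simp add: degree_def)
      then obtain t where "{j. j < n \<and> E x j} = {t}" by (rule card_1_singletonE)
      moreover have "y \<in> {j. j < n \<and> E x j}" "z \<in> {j. j < n \<and> E x j}"
        using that(2,3) sg by (auto simp: simple_graph_def)
      ultimately show ?thesis by simp
    qed
    have "{..<n} \<subseteq> {v, w}"
    proof (rule connected_closed)
      show "connected_graph n E" using tree by (simp add: is_tree_def)
      show "y \<in> {v, w}" if "x \<in> {v, w}" "E x y" for x y
        using that only[OF \<open>degree n E v = 1\<close> \<open>E v w\<close>, of y] only[OF \<open>degree n E w = 1\<close> \<open>E w v\<close>, of y]
        by auto
    qed (use vw in auto)
    then have "card {..<n} \<le> card {v, w}" by (intro card_mono) auto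
    also have "\<dots> \<le> 2" by (simp add: card_insert_if)
    finally show False using \<open>3 \<le> n\<close> by simp
  qed
qed (rule assms(3))

lemma sum_eq_single:
  fixes f :: "nat \<Rightarrow> real"
  assumes "finite A" "u \<in> A" "\<And>w. w \<in> A \<Longrightarrow> w \<noteq> u \<Longrightarrow> f w = 0"
  shows "sum f A = f u"
  using sum.mono_neutral_right[of A "{u}" f] assms by auto

text \<open>\<open>mult2\<close> excludes the degenerate cores: a single vertex in
  \<open>cn_nonempty\<close> and a single edge in \<open>ends_cn\<close>.\<close>

locale tree_eigenvalue = core_graph +
  assumes tree: "is_tree n E" and mult2: "2 \<le> lap_mult n E \<mu>"
begin

text \<open>Connectedness of the core: adding to \<open>X\<close> the leaves that hang from it gives
  a set closed under all edges of the tree.\<close>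

lemma core_closed:
  assumes "X \<subseteq> core" "v \<in> X" and cl: "\<And>x. x \<in> X \<Longrightarrow> cn x \<subseteq> X"
  shows "core = X"
proof -
  have "{..<n} \<subseteq> X \<union> {l \<in> leaves. stem l \<in> X}"
  proof (rule connected_closed[of n E v])
    show "connected_graph n E" using tree by (simp add: is_tree_def)
    show "v < n" using assms(1,2) by (auto simp: core_def)
    fix x y assume x: "x \<in> X \<union> {l \<in> leaves. stem l \<in> X}" and xy: "E x y"
    show "y \<in> X \<union> {l \<in> leaves. stem l \<in> X}"
    proof (cases "x \<in> X")
      case True
      have "y \<in> cn x \<union> pn x" using xy edgeD(2)[OF xy] neighbours_split(1) by blast
      then show ?thesis using cl[OF True] True by (auto simp: mem_pn_iff)
    next
      case False
      then have "x \<in> leaves" "stem x \<in> X" using x by auto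
      from stem_eq[OF this(1)] xy have "y = stem x" by (rule iffD1)
      then show ?thesis using \<open>stem x \<in> X\<close> by simp
    qed
  qed (use assms(2) in auto)
  then show ?thesis using assms(1) core_Int_leaves core_Un_leaves by blast
qed

lemma cn_nonempty:
  assumes "v \<in> core"
  shows "cn v \<noteq> {}"
proof
  assume "cn v = {}"
  then have c: "core = {v}" using core_closed[of "{v}" v] assms by simp
  have "{v} \<subseteq> {..<n}" using assms by (auto simp: core_def)
  then obtain f where f: "lap_eigfun n E \<mu> f" "\<exists>i<n. f i \<noteq> 0" "\<And>s. s \<in> {v} \<Longrightarrow> f s = 0"
    using eigfun_vanishing[OF simple, of "{v}" \<mu>] mult2 by auto
  then show False using eigfun_zero_if_core_zero[OF f(1)] c by auto
qed

definition ends :: "nat set" where "ends = {v \<in> core. card (cn v) = 1}"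
definition inner :: "nat set" where "inner = core - ends"

lemma finite_ends[simp]: "finite ends" and finite_inner[simp]: "finite inner"
  by (auto simp: ends_def inner_def)

lemma ends_core: "v \<in> ends \<Longrightarrow> v \<in> core" and inner_core: "v \<in> inner \<Longrightarrow> v \<in> core"
  and core_cases: "v \<in> core \<Longrightarrow> v \<in> ends \<or> v \<in> inner" and inner_ends: "v \<in> inner \<Longrightarrow> v \<notin> ends"
  by (auto simp: ends_def inner_def)

lemma core_split: "core = ends \<union> inner" "ends \<inter> inner = {}"
  by (auto simp: ends_def inner_def)

text \<open>The edges of the core with an end outside the zero set of \<open>f\<close> form a forest in which only
  \<open>u\<close> can have degree one, because a vanishing vertex balances at least two non-vanishing neighbours.\<close>

lemma eigfun_zero_if_ends_zero:
  assumes f: "lap_eigfun n E \<mu> f" and van: "\<And>v. v \<in> ends \<Longrightarrow> v \<noteq> u \<Longrightarrow> f v = 0" and "i < n"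
  shows "f i = 0"
proof (rule ccontr)
  assume "f i \<noteq> 0"
  then obtain v where v: "v \<in> core" "f v \<noteq> 0" using eigfun_zero_if_core_zero[OF f] \<open>i < n\<close> by blast
  define H where "H x y \<longleftrightarrow> x \<in> core \<and> y \<in> cn x \<and> (f x \<noteq> 0 \<or> f y \<noteq> 0)" for x y
  have sg: "simple_graph n H"
    unfolding simple_graph_def
  proof (intro allI impI)
    fix x y assume H: "H x y"
    then have "x \<in> core" "y \<in> cn x" by (auto simp: H_def)
    moreover then have "x \<in> cn y" "y \<in> core" "x \<noteq> y" using cn_sym cn_core cn_irrefl by blast+
    ultimately show "x < n \<and> y < n \<and> x \<noteq> y \<and> H y x" using H by (auto simp: H_def core_def)
  qed
  have two: "\<exists>w'. w' \<noteq> w \<and> H v w'" if vw: "H v w" and vu: "v \<noteq> u" for v w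
  proof (rule ccontr)
    assume no: "\<nexists>w'. w' \<noteq> w \<and> H v w'"
    have v: "v \<in> core" "w \<in> cn v" using vw by (auto simp: H_def)
    show False
    proof (cases "f v = 0")
      case True
      then have "f w' = 0" if "w' \<in> cn v" "w' \<noteq> w" for w' using no that v by (auto simp: H_def)
      then have "(\<Sum>w\<in>cn v. f w) = f w" using v(2) by (intro sum_eq_single) auto
      then show False using core_eq[OF f v(1)] True vw by (auto simp: H_def)
    next
      case False
      then have "cn v = {w}" using no v by (auto simp: H_def)
      then have "v \<in> ends" using v(1) by (auto simp: ends_def)
      then show False using van vu False by auto
    qed
  qed
  have "\<exists>vs. is_cycle n H vs"
  proof (cases "\<exists>w. H u w")
    case True
    then obtain w where "H u w" ..
    then show ?thesis using exists_cycle[OF sg, of u w] two by blast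
  next
    \<comment> \<open>\<open>u\<close> need not be an end nor lie on an edge of \<open>H\<close>. If
      it lies on none, no vertex is exceptional and the path may start at \<open>v\<close>.\<close>
    case False
    obtain w where "w \<in> cn v" using cn_nonempty[OF v(1)] by auto
    then have "H v w" using v by (auto simp: H_def)
    moreover have "\<exists>w'. w' \<noteq> y \<and> H x w'" if "H x y" for x y
      using two[OF that] False that by auto
    ultimately show ?thesis using exists_cycle[OF sg, of v w] by blast
  qed
  then obtain vs where "is_cycle n H vs" ..
  then have "is_cycle n E vs" by (auto simp: is_cycle_def H_def cn_def)
  then show False using tree by (auto simp: is_tree_def)
qed

lemma sub_ends: "X \<subseteq> ends \<Longrightarrow> X \<subseteq> {..<n}"
  by (auto simp: ends_def core_def)

lemma mult_less_card_ends: "lap_mult n E \<mu> < card ends"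
proof (rule ccontr)
  assume le: "\<not> lap_mult n E \<mu> < card ends"
  \<comment> \<open>Without ends \<open>u\<close> is arbitrary and the empty set of zeros is small
    enough by \<open>mult2\<close>.\<close>
  obtain u where u: "ends = {} \<or> u \<in> ends" by blast
  have "card (ends - {u}) < lap_mult n E \<mu>"
  proof (cases "ends = {}")
    case True
    then show ?thesis using mult2 by simp
  next
    case False
    then have "card ends > 0" by (simp add: card_gt_0_iff)
    then show ?thesis using u False le by (simp add: card_Diff_singleton)
  qed
  then obtain f where f: "lap_eigfun n E \<mu> f" "\<exists>i<n. f i \<noteq> 0" "\<And>s. s \<in> ends - {u} \<Longrightarrow> f s = 0"
    using eigfun_vanishing[OF simple sub_ends[of "ends - {u}"]] by blast
  then show False using eigfun_zero_if_ends_zero[OF f(1), of u] by auto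
qed

text \<open>An end has one core neighbour but is no leaf of the tree, so its degree exceeds one and
  the surplus consists of leaves.\<close>

lemma ends_pn: "v \<in> ends \<Longrightarrow> 1 \<le> card (pn v)"
  using degree_split[of v] by (auto simp: ends_def core_def)

text \<open>Pairs every end with one of its leaves. The other three summands count what lies beyond
  the pairs; the extremal order limits them to 3 or 1 in total.\<close>

lemma card_vertices:
  "n = 2 * card ends + card inner + (\<Sum>v\<in>ends. card (pn v) - 1) + (\<Sum>v\<in>inner. card (pn v))"
proof -
  have "n = card (core \<union> leaves)" by (simp add: core_Un_leaves)
  also have "\<dots> = card core + card leaves" by (rule card_Un_disjoint) (auto simp: core_Int_leaves)
  also have "card core = card ends + card inner"
    unfolding core_split(1) by (rule card_Un_disjoint) (auto simp: core_split(2))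
  also have "card leaves = (\<Sum>v\<in>ends. card (pn v)) + (\<Sum>v\<in>inner. card (pn v))"
    unfolding card_leaves core_split(1) by (rule sum.union_disjoint) (auto simp: core_split(2))
  also have "(\<Sum>v\<in>ends. card (pn v)) = (\<Sum>v\<in>ends. (card (pn v) - 1) + 1)"
  proof (intro sum.cong refl)
    fix v assume "v \<in> ends"
    then show "card (pn v) = card (pn v) - 1 + 1" using ends_pn[of v] by simp
  qed
  also have "\<dots> = (\<Sum>v\<in>ends. card (pn v) - 1) + card ends" by (simp only: sum.distrib) simp
  finally show ?thesis by simp
qed

text \<open>Two adjacent ends would be the whole core, while there are more than
  \<open>lap_mult n E \<mu>\<close>, hence at least three, ends.\<close>

lemma ends_cn:
  assumes "u \<in> ends"
  obtains x where "x \<in> inner" "cn u = {x}"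
proof -
  obtain x where x: "cn u = {x}" using assms by (auto simp: ends_def card_1_singleton_iff)
  have "x \<in> inner"
  proof (rule ccontr)
    assume "x \<notin> inner"
    then have xe: "x \<in> ends" using x cn_core core_cases by blast
    then obtain y where y: "cn x = {y}" by (auto simp: ends_def card_1_singleton_iff)
    have "u \<in> cn x" using cn_sym[of u x] x ends_core[OF assms] by simp
    then have "cn x = {u}" using y by simp
    then have "core = {u, x}" using core_closed[of "{u,x}" u] x xe assms ends_core by auto
    then have "ends \<subseteq> {u, x}" using ends_core by auto
    then have "card ends \<le> card {u, x}" by (intro card_mono) auto
    also have "\<dots> \<le> 2" by (simp add: card_insert_if)
    finally show False using mult_less_card_ends mult2 by simp
  qed
  then show thesis using that x by blast
qed

lemma inner_nonempty: "inner \<noteq> {}"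
proof -
  have "ends \<noteq> {}" using mult_less_card_ends by auto
  then show ?thesis using ends_cn by (metis all_not_in_conv)
qed

lemma ends_cn_iff: "u \<in> ends \<Longrightarrow> x \<in> core \<Longrightarrow> u \<in> cn x \<longleftrightarrow> cn u = {x}"
proof -
  assume u: "u \<in> ends" and x: "x \<in> core"
  obtain y where "cn u = {y}" using ends_cn[OF u] by metis
  then show ?thesis using cn_sym[OF x, of u] cn_sym[OF ends_core[OF u], of x] by auto
qed

text \<open>Used in two ways: a zero at an end passes to its neighbour (\<open>end_zero\<close>),
  and a nonzero end next to a zero makes its coefficient vanish
  (\<open>end_leg_coeff\<close>).\<close>

lemma end_eq:
  assumes "lap_eigfun n E \<mu> f" "u \<in> ends" "cn u = {x}"
  shows "leg_coeff 1 (card (pn u)) * f u = f x"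
  using core_eq[OF assms(1) ends_core[OF assms(2)]] assms(3) by simp

lemma end_zero:
  assumes "lap_eigfun n E \<mu> f" "u \<in> ends" "cn u = {x}" "f u = 0"
  shows "f x = 0"
  using end_eq[OF assms(1-3)] assms(4) by simp

lemma end_leg_coeff:
  assumes "lap_eigfun n E \<mu> f" "u \<in> ends" "cn u = {x}" "f u \<noteq> 0" "f x = 0"
  shows "leg_coeff 1 (card (pn u)) = 0"
  using end_eq[OF assms(1-3)] assms(4,5) by simp

lemma inner_card_cn: "x \<in> inner \<Longrightarrow> 2 \<le> card (cn x)"
proof -
  assume x: "x \<in> inner"
  then have "card (cn x) \<noteq> 1" by (auto simp: inner_def ends_def)
  moreover have "card (cn x) \<noteq> 0" using cn_nonempty[OF inner_core[OF x]] by simp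
  ultimately show ?thesis by linarith
qed

text \<open>If all neighbours of \<open>x\<close> were ends, \<open>x\<close> with its neighbours
  would be closed, hence the whole core, and would miss \<open>y\<close>.\<close>

lemma inner_neighbour:
  assumes "x \<in> inner" "y \<in> inner" "x \<noteq> y"
  obtains z where "z \<in> inner" "z \<in> cn x"
proof (rule ccontr)
  assume no: "\<not> thesis"
  have sub: "cn x \<subseteq> ends" using no that cn_core core_cases by blast
  have "core = insert x (cn x)"
  proof (rule core_closed[of _ x])
    show "insert x (cn x) \<subseteq> core" using inner_core[OF assms(1)] cn_core by auto
    show "cn w \<subseteq> insert x (cn x)" if "w \<in> insert x (cn x)" for w
      using that sub ends_cn_iff[OF _ inner_core[OF assms(1)]] by auto
  qed simp
  then have "y \<in> ends" using assms(3) sub inner_core[OF assms(2)] by auto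
  then show False using inner_ends[OF assms(2)] by simp
qed

section \<open>Cores with a single inner vertex\<close>

lemma single_inner_cn: 
  assumes "inner = {c}" "u \<in> ends"
  shows "cn u = {c}"
  using ends_cn[OF assms(2)] assms(1) by auto

text \<open>All ends but two are one fewer than the multiplicity, so they can be made zeros. A
  further zero at \<open>u\<close> or \<open>v\<close> would leave a single end and force the
  function to be zero.\<close>

lemma two_ends_eigfun:
  assumes q: "card ends = lap_mult n E \<mu> + 1" and uv: "u \<in> ends" "v \<in> ends" "u \<noteq> v"
  obtains f where "lap_eigfun n E \<mu> f" "f u \<noteq> 0" "f v \<noteq> 0"
    "\<And>w. w \<in> ends \<Longrightarrow> w \<noteq> u \<Longrightarrow> w \<noteq> v \<Longrightarrow> f w = 0"
proof -
  have "card (ends - {u, v}) < lap_mult n E \<mu>"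
    using q uv mult2 by (subst card_Diff_subset) auto
  then obtain f where f: "lap_eigfun n E \<mu> f" "\<exists>i<n. f i \<noteq> 0" "\<And>s. s \<in> ends - {u, v} \<Longrightarrow> f s = 0"
    using eigfun_vanishing[OF simple sub_ends[of "ends - {u,v}"]] by blast
  have "f u \<noteq> 0" using eigfun_zero_if_ends_zero[OF f(1), of v] f(2,3) by auto
  moreover have "f v \<noteq> 0" using eigfun_zero_if_ends_zero[OF f(1), of u] f(2,3) by auto
  ultimately show thesis using that f(1,3) by auto
qed

text \<open>A third end carries a zero to \<open>c\<close>, so every leg coefficient vanishes and
  all ends have equally many leaves. A second leaf at each would cost at least three vertices, but
  \<open>ex\<close> provides two.\<close>

lemma single_inner_max:
  assumes c: "inner = {c}" and q: "card ends = lap_mult n E \<mu> + 1"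
    and ex: "(\<Sum>v\<in>ends. card (pn v) - 1) + card (pn c) = 2"
  shows "leg_coeff 1 1 = 0" "\<And>u. u \<in> ends \<Longrightarrow> card (pn u) = 1" "card (pn c) = 2"
proof -
  have q3: "3 \<le> card ends" using q mult2 by simp
  have zero: "leg_coeff 1 (card (pn u)) = 0" if u: "u \<in> ends" for u
  proof -
    have "card (ends - {u}) \<ge> 2" using q3 u by (simp add: card_Diff_singleton)
    then obtain v where v: "v \<in> ends" "v \<noteq> u" by (metis Diff_iff all_not_in_conv card.empty insertI1 not_numeral_le_zero)
    have "card (ends - {u, v}) \<ge> 1" using q3 u v by (subst card_Diff_subset) auto
    then obtain w where w: "w \<in> ends" "w \<noteq> u" "w \<noteq> v"
      by (metis Diff_iff all_not_in_conv card.empty insert_iff not_one_le_zero)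
    obtain f where f: "lap_eigfun n E \<mu> f" "f u \<noteq> 0" "f v \<noteq> 0"
      "\<And>w. w \<in> ends \<Longrightarrow> w \<noteq> u \<Longrightarrow> w \<noteq> v \<Longrightarrow> f w = 0"
      using two_ends_eigfun[OF q u v(1)] v(2) by auto
    have "f c = 0" using end_zero[OF f(1) w(1) single_inner_cn[OF c w(1)]] f(4)[OF w] by simp
    then show ?thesis using end_leg_coeff[OF f(1) u single_inner_cn[OF c u] f(2)] by simp
  qed
  show one: "card (pn u) = 1" if u: "u \<in> ends" for u
  proof (rule ccontr)
    assume "card (pn u) \<noteq> 1"
    then have "1 \<le> card (pn v) - 1" if "v \<in> ends" for v
      using leg_coeff_zero_inj[OF zero[OF u] zero[OF that]] ends_pn[OF u] by simp
    then have "(\<Sum>v\<in>ends. 1) \<le> (\<Sum>v\<in>ends. card (pn v) - 1)" by (intro sum_mono) auto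
    then show False using ex q3 by simp
  qed
  show "card (pn c) = 2" using ex one by simp
  obtain u where "u \<in> ends" using q by fastforce
  then show "leg_coeff 1 1 = 0" using zero[of u] one[of u] by simp
qed

text \<open>One zero end makes \<open>c\<close> vanish, and a nonzero end then forces
  \<open>leg_coeff 1 1 = 0\<close>. In that case the legs alone push the multiplicity up to the
  number of ends minus one, which is one too many.\<close>

lemma single_inner_not_all_legs:
  assumes c: "inner = {c}" and q: "card ends = lap_mult n E \<mu> + 2"
    and one: "\<And>u. u \<in> ends \<Longrightarrow> card (pn u) = 1"
  shows False
proof -
  \<comment> \<open>The largest number of zeros that can be prescribed; \<open>mult2\<close> makes
    it positive, so \<open>X\<close> supplies the zero end.\<close>
  obtain X where X: "X \<subseteq> ends" "card X = lap_mult n E \<mu> - 1"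
    using obtain_subset_with_card_n[of "lap_mult n E \<mu> - 1" ends] q
    by (metis diff_le_self le_add1 order_trans)
  obtain f where f: "lap_eigfun n E \<mu> f" "\<exists>i<n. f i \<noteq> 0" "\<And>s. s \<in> X \<Longrightarrow> f s = 0"
    using eigfun_vanishing[OF simple sub_ends[OF X(1)], of \<mu>] X(2) mult2 by auto
  obtain w where w: "w \<in> X" using X(2) mult2 by fastforce
  then have we: "w \<in> ends" using X by auto
  have fc: "f c = 0" using end_zero[OF f(1) we single_inner_cn[OF c we]] f(3)[OF w] by simp
  obtain u where u: "u \<in> ends" "f u \<noteq> 0" using eigfun_zero_if_ends_zero[OF f(1)] f(2) by blast
  have "leg_coeff 1 1 = 0"
    using end_leg_coeff[OF f(1) u(1) single_inner_cn[OF c u(1)] u(2) fc] one[OF u(1)] by simp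
  moreover have "c \<in> core" using c inner_core by auto
  ultimately have "card ends \<le> lap_mult n E \<mu> + 1"
    using card_legs_le[of ends c] single_inner_cn[OF c] one ends_core by auto
  then show False using q by simp
qed

end

section \<open>The extremal trees\<close>

context tree_eigenvalue
begin

section \<open>Cores with two or three inner vertices\<close>

lemma inner_cn_split:
  assumes "x \<in> inner"
  shows "cn x = (cn x \<inter> inner) \<union> {u \<in> ends. cn u = {x}}"
    "(\<Sum>w\<in>cn x. f w) = (\<Sum>w\<in>cn x \<inter> inner. f w) + (\<Sum>w | w \<in> ends \<and> cn w = {x}. f w :: real)"
proof -
  show *: "cn x = (cn x \<inter> inner) \<union> {u \<in> ends. cn u = {x}}"
    using ends_cn_iff[OF _ inner_core[OF assms]] cn_core[of _ x] core_cases by blast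
  have "(\<Sum>w\<in>(cn x \<inter> inner) \<union> {u \<in> ends. cn u = {x}}. f w)
    = (\<Sum>w\<in>cn x \<inter> inner. f w) + (\<Sum>w | w \<in> ends \<and> cn w = {x}. f w)"
    by (rule sum.union_disjoint) (auto simp: inner_ends)
  with * show "(\<Sum>w\<in>cn x. f w) = (\<Sum>w\<in>cn x \<inter> inner. f w) + (\<Sum>w | w \<in> ends \<and> cn w = {x}. f w)"
    by simp
qed

text \<open>The zero at \<open>x\<close> removes its coefficient, so the only possibly nonzero end
  at \<open>x\<close> must be balanced by inner neighbours.\<close>

lemma inner_eq_zero:
  assumes f: "lap_eigfun n E \<mu> f" and x: "x \<in> inner" "f x = 0"
    and u: "u \<in> ends" "cn u = {x}" "\<And>w. w \<in> ends \<Longrightarrow> cn w = {x} \<Longrightarrow> w \<noteq> u \<Longrightarrow> f w = 0"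
  shows "(\<Sum>w\<in>cn x \<inter> inner. f w) + f u = 0"
proof -
  have "(\<Sum>w | w \<in> ends \<and> cn w = {x}. f w) = f u"
    by (rule sum_eq_single) (use u in auto)
  then show ?thesis using core_eq[OF f inner_core[OF x(1)]] x(2) inner_cn_split(2)[OF x(1), of f] by simp
qed

lemma inner_eq_zero':
  assumes f: "lap_eigfun n E \<mu> f" and x: "x \<in> inner" "f x = 0"
    and u: "\<And>w. w \<in> ends \<Longrightarrow> cn w = {x} \<Longrightarrow> f w = 0"
  shows "(\<Sum>w\<in>cn x \<inter> inner. f w) = 0"
proof -
  have "(\<Sum>w | w \<in> ends \<and> cn w = {x}. f w) = 0" using u by (intro sum.neutral) auto
  then show ?thesis using core_eq[OF f inner_core[OF x(1)]] x(2) inner_cn_split(2)[OF x(1), of f] by simp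
qed

text \<open>An inner vertex has at least two core neighbours, and only one of them is inner
  here.\<close>

lemma end_exists:
  assumes "x \<in> inner" "cn x \<inter> inner = {y}"
  obtains u where "u \<in> ends" "cn u = {x}"
proof (rule ccontr)
  assume no: "\<not> thesis"
  then have "cn x = {y}" using inner_cn_split(1)[OF assms(1)] assms(2) that by blast
  then show False using inner_card_cn[OF assms(1)] by simp
qed

text \<open>An eigenfunction on \<open>u1\<close> and \<open>v\<close> vanishes at
  \<open>u2\<close>, hence at \<open>x\<close>. So the ends \<open>u1\<close> and \<open>u2\<close>
  have equally many leaves, and as only one vertex is left over, one each. This forces
  \<open>v\<close> to be the only end at \<open>y\<close> and to have two leaves, after which the
  equation at \<open>y\<close> fails.\<close>

lemma no_two_inner_aux:
  assumes I: "inner = {x, y}" "x \<noteq> y" and xy: "cn x \<inter> inner = {y}" "cn y \<inter> inner = {x}"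
    and q: "card ends = lap_mult n E \<mu> + 1"
    and ex: "(\<Sum>v\<in>ends. card (pn v) - 1) + (card (pn x) + card (pn y)) = 1"
    and u1: "u1 \<in> ends" "cn u1 = {x}" and u2: "u2 \<in> ends" "cn u2 = {x}" and ne: "u1 \<noteq> u2"
  shows False
proof -
  have xi: "x \<in> inner" "y \<in> inner" using I by auto
  obtain v where v: "v \<in> ends" "cn v = {y}" using end_exists[OF xi(2) xy(2)] by blast
  have "\<exists>f. lap_eigfun n E \<mu> f \<and> f u \<noteq> 0 \<and> f x = 0 \<and> f y = - f u \<and> leg_coeff 1 (card (pn u)) = 0
      \<and> (\<forall>w\<in>ends. w \<noteq> u \<longrightarrow> w \<noteq> v \<longrightarrow> f w = 0)"
    if u: "u \<in> ends" "cn u = {x}" and u': "u' \<in> ends" "cn u' = {x}" and "u \<noteq> u'" for u u'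
  proof -
    have "u \<noteq> v" "u' \<noteq> v" using u u' v I(2) by auto
    obtain f where f: "lap_eigfun n E \<mu> f" "f u \<noteq> 0" "f v \<noteq> 0"
      "\<And>w. w \<in> ends \<Longrightarrow> w \<noteq> u \<Longrightarrow> w \<noteq> v \<Longrightarrow> f w = 0"
      using two_ends_eigfun[OF q u(1) v(1) \<open>u \<noteq> v\<close>] by blast
    have fx: "f x = 0" using end_zero[OF f(1) u'] f(4)[OF u'(1)] \<open>u \<noteq> u'\<close> \<open>u' \<noteq> v\<close> by simp
    have "f y + f u = 0"
      using inner_eq_zero[OF f(1) xi(1) fx u] f(4) v(2) I(2) unfolding xy(1) by auto
    then show ?thesis using f fx end_leg_coeff[OF f(1) u f(2) fx] by (intro exI[of _ f]) auto
  qed note key = this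
  obtain f where f: "lap_eigfun n E \<mu> f" "f u1 \<noteq> 0" "f x = 0" "f y = - f u1"
    "leg_coeff 1 (card (pn u1)) = 0" "\<And>w. w \<in> ends \<Longrightarrow> w \<noteq> u1 \<Longrightarrow> w \<noteq> v \<Longrightarrow> f w = 0"
    using key[OF u1 u2 ne] by blast
  have "leg_coeff 1 (card (pn u2)) = 0" using key[OF u2 u1] ne by auto
  then have same: "card (pn u1) = card (pn u2)" using leg_coeff_zero_inj f(5) by blast
  have exs: "(\<Sum>w\<in>W. card (pn w) - 1) + (card (pn x) + card (pn y)) \<le> 1" if "W \<subseteq> ends" for W
    using sum_mono2[OF finite_ends that, of "\<lambda>w. card (pn w) - 1"] ex by simp
  have "card (pn u1) = 1"
    using exs[of "{u1, u2}"] same ne u1(1) u2(1) ends_pn[OF u1(1)] by auto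
  then have golden: "leg_coeff 1 1 = 0" using f(5) by simp
  have only: "w = v" if "w \<in> ends" "cn w = {y}" for w
  proof (rule ccontr)
    assume "w \<noteq> v"
    moreover have "w \<noteq> u1" using that u1 I(2) by auto
    ultimately have "f y = 0" using end_zero[OF f(1) that] f(6)[OF that(1)] by simp
    then show False using f(2,4) by simp
  qed
  have veq: "leg_coeff 1 (card (pn v)) * f v = f y" by (rule end_eq[OF f(1) v])
  then have "card (pn v) \<noteq> 1" using golden f(2,4) by auto
  then have "2 \<le> card (pn v)" using ends_pn[OF v(1)] by linarith
  moreover have "(card (pn v) - 1) + (card (pn x) + card (pn y)) \<le> 1" using exs[of "{v}"] v(1) by simp
  ultimately have pv: "card (pn v) = 2" "card (pn y) = 0" by linarith+
  have "{w \<in> ends. cn w = {y}} = {v}" using only v by blast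
  then have cny: "cn y = {x, v}" using inner_cn_split(1)[OF xi(2)] xy(2) by auto
  have "x \<noteq> v" using v(1) xi(1) inner_ends by auto
  then have yeq: "leg_coeff 2 0 * f y = f v"
    using core_eq[OF f(1) inner_core[OF xi(2)]] pv(2) f(3) unfolding cny by (simp add: numeral_2_eq_2)
  \<comment> \<open>In \<open>t\<close> the quadratic reads \<open>t * t + t = 1\<close>, so
    \<open>1 / t = t + 1\<close>, and the coefficients at \<open>v\<close> and \<open>y\<close> are
    \<open>- t\<close> and \<open>1 + t\<close>. Their product is -1, whereas the two equations ask
    for 1.\<close>
  define t where "t = 1 - \<mu>"
  have t0: "t \<noteq> 0" using mu1 by (simp add: t_def)
  have tt: "t * t + t - 1 = 0"
    using golden t0 by (simp add: leg_coeff_def t_def[symmetric] field_simps) (simp add: t_def algebra_simps)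
  have inv: "1 / t = t + 1" using tt t0 by (simp add: field_simps)
  have "leg_coeff 1 2 = 2 + t - 2 * (1 / t)" by (simp add: leg_coeff_def t_def)
  then have "leg_coeff 1 2 = - t" unfolding inv by simp
  then have fy: "f y = - t * f v" using veq pv(1) by simp
  have "leg_coeff 2 0 = 1 + t" by (simp add: leg_coeff_def t_def)
  then have "(1 + t) * (- t * f v) = f v" using yeq fy by simp
  then have "(t * t + t + 1) * f v = 0" by (simp add: algebra_simps)
  moreover have "t * t + t + 1 = 2" using tt by simp
  ultimately have "f v = 0" by simp
  then show False using fy f(2,4) by simp
qed

lemma ends_card_ge3:
  assumes "card ends = lap_mult n E \<mu> + 1"
  shows "3 \<le> card ends"
  using assms mult2 by simp

text \<open>Pigeonhole: three ends, two attachment points.\<close>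

lemma ends_partition_two:
  assumes A: "\<And>u. u \<in> ends \<Longrightarrow> cn u = {x} \<or> cn u = {z}" and q: "3 \<le> card ends"
  shows "(\<exists>u1 u2. u1 \<in> ends \<and> cn u1 = {x} \<and> u2 \<in> ends \<and> cn u2 = {x} \<and> u1 \<noteq> u2) \<or>
    (\<exists>u1 u2. u1 \<in> ends \<and> cn u1 = {z} \<and> u2 \<in> ends \<and> cn u2 = {z} \<and> u1 \<noteq> u2)"
proof (rule ccontr)
  assume no: "\<not> ?thesis"
  have "card {u \<in> ends. cn u = {x}} \<le> Suc 0" "card {u \<in> ends. cn u = {z}} \<le> Suc 0"
    using no by (subst card_le_Suc0_iff_eq, simp, blast)+
  moreover have "ends = {u \<in> ends. cn u = {x}} \<union> {u \<in> ends. cn u = {z}}" using A by auto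
  then have "card ends \<le> card {u \<in> ends. cn u = {x}} + card {u \<in> ends. cn u = {z}}"
    by (metis card_Un_le)
  ultimately show False using q by simp
qed

lemma no_two_inner:
  assumes I: "inner = {x, y}" "x \<noteq> y" and q: "card ends = lap_mult n E \<mu> + 1"
    and ex: "(\<Sum>v\<in>ends. card (pn v) - 1) + (\<Sum>v\<in>inner. card (pn v)) = 1"
  shows False
proof -
  have xi: "x \<in> inner" "y \<in> inner" using I by auto
  obtain z where "z \<in> inner" "z \<in> cn x" using inner_neighbour[OF xi I(2)] by blast
  then have "y \<in> cn x" using I cn_irrefl[of x] by auto
  then have "x \<in> cn y" using cn_sym[OF inner_core[OF xi(1)]] by blast
  have cx: "cn x \<inter> inner = {y}" using I cn_irrefl[of x] \<open>y \<in> cn x\<close> by auto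
  have cy: "cn y \<inter> inner = {x}" using I cn_irrefl[of y] \<open>x \<in> cn y\<close> by auto
  have xy: "cn u = {x} \<or> cn u = {y}" if "u \<in> ends" for u
    by (rule ends_cn[OF that]) (auto simp: I)
  have part: "(\<exists>u1 u2. u1 \<in> ends \<and> cn u1 = {x} \<and> u2 \<in> ends \<and> cn u2 = {x} \<and> u1 \<noteq> u2) \<or>
    (\<exists>u1 u2. u1 \<in> ends \<and> cn u1 = {y} \<and> u2 \<in> ends \<and> cn u2 = {y} \<and> u1 \<noteq> u2)"
    by (rule ends_partition_two) (use xy ends_card_ge3[OF q] in auto)
  have ex': "(\<Sum>v\<in>ends. card (pn v) - 1) + (card (pn x) + card (pn y)) = 1"
    using ex I by simp
  have I': "inner = {y, x}" using I by auto
  have ex'': "(\<Sum>v\<in>ends. card (pn v) - 1) + (card (pn y) + card (pn x)) = 1" using ex' by simp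
  from part show False
  proof (elim disjE exE conjE)
    fix u1 u2
    assume "u1 \<in> ends" "cn u1 = {x}" "u2 \<in> ends" "cn u2 = {x}" "u1 \<noteq> u2"
    then show False using no_two_inner_aux[OF I cx cy q ex'] by blast
  next
    fix u1 u2
    assume "u1 \<in> ends" "cn u1 = {y}" "u2 \<in> ends" "cn u2 = {y}" "u1 \<noteq> u2"
    then show False using no_two_inner_aux[OF I' I(2)[symmetric] cy cx q ex''] by blast
  qed
qed

text \<open>Once \<open>leg_coeff 1 1 = 0\<close>, every vertex that carries an end vanishes. An
  eigenfunction on an end of \<open>x\<close> and an end of \<open>z\<close> is then zero on the
  whole inner path, and nothing balances \<open>u\<close> at \<open>x\<close>.\<close>

lemma no_inner_path:
  assumes I: "inner = {x, y, z}" "x \<noteq> y" "y \<noteq> z" "x \<noteq> z"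
    and cx: "cn x \<inter> inner = {y}" and cy: "cn y \<inter> inner = {x, z}" and cz: "cn z \<inter> inner = {y}"
    and q: "card ends = lap_mult n E \<mu> + 1"
    and one: "\<And>u. u \<in> ends \<Longrightarrow> card (pn u) = 1" and zero: "\<And>v. v \<in> inner \<Longrightarrow> card (pn v) = 0"
  shows False
proof -
  have xi: "x \<in> inner" "y \<in> inner" "z \<in> inner" using I by auto
  obtain u where u: "u \<in> ends" "cn u = {x}" using end_exists[OF xi(1) cx] by blast
  obtain v where v: "v \<in> ends" "cn v = {z}" using end_exists[OF xi(3) cz] by blast
  have uv: "u \<noteq> v" using u v I by auto
  \<comment> \<open>With an end \<open>w\<close> at \<open>y\<close>, an eigenfunction on
    \<open>u\<close> and \<open>w\<close> is zero at all ends of \<open>z\<close>, so at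
    \<open>z\<close>, and by the equation at \<open>z\<close> also at \<open>y\<close>. Otherwise
    two ends share \<open>x\<close> or \<open>z\<close>; using one of them and an end of the other
    side makes the shared neighbour vanish.\<close>
  have golden: "leg_coeff 1 1 = 0"
  proof (cases "\<exists>w\<in>ends. cn w = {y}")
    case True
    then obtain w where w: "w \<in> ends" "cn w = {y}" by blast
    then have "u \<noteq> w" using u I by auto
    obtain f where f: "lap_eigfun n E \<mu> f" "f u \<noteq> 0" "f w \<noteq> 0"
      "\<And>t. t \<in> ends \<Longrightarrow> t \<noteq> u \<Longrightarrow> t \<noteq> w \<Longrightarrow> f t = 0"
      using two_ends_eigfun[OF q u(1) w(1) \<open>u \<noteq> w\<close>] by blast
    have Lz: "f t = 0" if "t \<in> ends" "cn t = {z}" for t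
      by (rule f(4)[OF that(1)]) (use that u w I in auto)
    have fz: "f z = 0" by (rule end_zero[OF f(1) v Lz[OF v]])
    have "f y = 0" using inner_eq_zero'[OF f(1) xi(3) fz Lz] unfolding cz by simp
    then show ?thesis using end_leg_coeff[OF f(1) w f(3)] one[OF w(1)] by simp
  next
    case False
    have xz: "cn t = {x} \<or> cn t = {z}" if "t \<in> ends" for t
      by (rule ends_cn[OF that]) (use False that I in auto)
    have "(\<exists>u1 u2. u1 \<in> ends \<and> cn u1 = {x} \<and> u2 \<in> ends \<and> cn u2 = {x} \<and> u1 \<noteq> u2) \<or>
      (\<exists>u1 u2. u1 \<in> ends \<and> cn u1 = {z} \<and> u2 \<in> ends \<and> cn u2 = {z} \<and> u1 \<noteq> u2)"
      by (rule ends_partition_two) (use xz ends_card_ge3[OF q] in auto)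
    then show ?thesis
    proof (elim disjE exE conjE)
      fix u1 u2
      assume u1: "u1 \<in> ends" "cn u1 = {x}" and u2: "u2 \<in> ends" "cn u2 = {x}" and "u1 \<noteq> u2"
      have ne: "u1 \<noteq> v" "u2 \<noteq> v" using u1 u2 v I by auto
      obtain f where f: "lap_eigfun n E \<mu> f" "f u1 \<noteq> 0"
        "\<And>t. t \<in> ends \<Longrightarrow> t \<noteq> u1 \<Longrightarrow> t \<noteq> v \<Longrightarrow> f t = 0"
        using two_ends_eigfun[OF q u1(1) v(1) ne(1)] by blast
      have "f x = 0" using end_zero[OF f(1) u2] f(3)[OF u2(1)] ne \<open>u1 \<noteq> u2\<close> by simp
      then show ?thesis using end_leg_coeff[OF f(1) u1 f(2)] one[OF u1(1)] by simp
    next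
      fix v1 v2
      assume v1: "v1 \<in> ends" "cn v1 = {z}" and v2: "v2 \<in> ends" "cn v2 = {z}" and "v1 \<noteq> v2"
      have ne: "v1 \<noteq> u" "v2 \<noteq> u" using v1 v2 u I by auto
      obtain f where f: "lap_eigfun n E \<mu> f" "f v1 \<noteq> 0"
        "\<And>t. t \<in> ends \<Longrightarrow> t \<noteq> v1 \<Longrightarrow> t \<noteq> u \<Longrightarrow> f t = 0"
        using two_ends_eigfun[OF q v1(1) u(1) ne(1)] by blast
      have "f z = 0" using end_zero[OF f(1) v2] f(3)[OF v2(1)] ne \<open>v1 \<noteq> v2\<close> by simp
      then show ?thesis using end_leg_coeff[OF f(1) v1 f(2)] one[OF v1(1)] by simp
    qed
  qed
  then have poly: "\<mu>\<^sup>2 - 3 * \<mu> + 1 = 0" by (simp only: leg_coeff_1_1_zero_iff)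
  have centre: "f w = 0" if "lap_eigfun n E \<mu> f" "t \<in> ends" "cn t = {w}" for f t w
    using end_eq[OF that] one[OF that(2)] golden by simp
  obtain f where f: "lap_eigfun n E \<mu> f" "f u \<noteq> 0"
    "\<And>t. t \<in> ends \<Longrightarrow> t \<noteq> u \<Longrightarrow> t \<noteq> v \<Longrightarrow> f t = 0"
    using two_ends_eigfun[OF q u(1) v(1) uv] by blast
  have fx: "f x = 0" and fz: "f z = 0" using centre[OF f(1) u] centre[OF f(1) v] by auto
  have "f y = 0"
  proof (cases "\<exists>w\<in>ends. cn w = {y}")
    case True
    then show ?thesis using centre[OF f(1)] by blast
  next
    case False
    then have cny: "cn y = {x, z}" using inner_cn_split(1)[OF xi(2)] cy by auto
    have "leg_coeff 2 0 * f y = 0"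
      using core_eq[OF f(1) inner_core[OF xi(2)]] zero[OF xi(2)] fx fz I(4) unfolding cny
      by (simp add: numeral_2_eq_2)
    \<comment> \<open>The coefficient is \<open>2 - \<mu>\<close>, and 2 is not a root of the
      quadratic.\<close>
    moreover have "leg_coeff 2 0 \<noteq> 0" using poly by (auto simp: leg_coeff_def power2_eq_square)
    ultimately show ?thesis by simp
  qed
  moreover have "f y + f u = 0"
    using inner_eq_zero[OF f(1) xi(1) fx u] f(3) v(2) I(4) unfolding cx by auto
  ultimately show False using f(2) by simp
qed

text \<open>Each inner vertex has an inner neighbour and a triangle would be a cycle, so the three
  form a path in some order.\<close>

lemma no_three_inner:
  assumes I: "card inner = 3" and q: "card ends = lap_mult n E \<mu> + 1"
    and one: "\<And>u. u \<in> ends \<Longrightarrow> card (pn u) = 1" and zero: "\<And>v. v \<in> inner \<Longrightarrow> card (pn v) = 0"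
  shows False
proof -
  obtain a b c where abc: "inner = {a, b, c}" "a \<noteq> b" "b \<noteq> c" "a \<noteq> c"
    using I by (auto simp: card_3_iff)
  define A where "A x y \<longleftrightarrow> y \<in> cn x" for x y
  have sym: "A x y \<longleftrightarrow> A y x" if "x \<in> inner" "y \<in> inner" for x y
    using cn_sym inner_core that unfolding A_def by blast
  have path: False if p: "inner = {x, y, z}" "x \<noteq> y" "y \<noteq> z" "x \<noteq> z" "A x y" "A y z" "\<not> A x z" for x y z
  proof -
    have "A y x" "A z y" "\<not> A z x" using p sym by auto
    then show False
      using no_inner_path[OF p(1-4) _ _ _ q one zero] p cn_irrefl unfolding A_def by auto
  qed
  have nb: "\<exists>z\<in>inner. A x z" if "x \<in> inner" for x
  proof -
    obtain y where "y \<in> inner" "x \<noteq> y" using abc(1,2) by blast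
    then show ?thesis using inner_neighbour[OF that] unfolding A_def by metis
  qed
  have no_tri: "\<not> (A a b \<and> A b c \<and> A c a)"
  proof
    assume tri: "A a b \<and> A b c \<and> A c a"
    then have "is_cycle n E [a, b, c]"
      using abc edgeD(1,2) by (auto simp: is_cycle_def A_def cn_def less_Suc_eq nth_Cons')
    then show False using tree by (auto simp: is_tree_def)
  qed
  have irr: "\<not> A x x" for x using cn_irrefl by (auto simp: A_def)
  have s: "A a b = A b a" "A b c = A c b" "A a c = A c a" using sym abc by auto
  have na: "A a b \<or> A a c" "A b a \<or> A b c" "A c a \<or> A c b"
    using nb[of a] nb[of b] nb[of c] abc(1) irr by auto
  \<comment> \<open>Together with \<open>abc(1)\<close> these orders put each vertex in the middle
    once.\<close>
  have i2: "inner = {b, a, c}" "inner = {a, c, b}" using abc(1) by auto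
  show False
    using path[OF abc(1)] path[OF i2(1)] path[OF i2(2)] abc(2-4) no_tri s na by metis
qed

lemma extremal_structure:
  assumes n: "n = 2 * lap_mult n E \<mu> + 5"
  obtains c where "inner = {c}" "card ends = lap_mult n E \<mu> + 1" "leg_coeff 1 1 = 0"
    "\<And>u. u \<in> ends \<Longrightarrow> cn u = {c}" "\<And>u. u \<in> ends \<Longrightarrow> card (pn u) = 1" "card (pn c) = 2"
proof -
  let ?x = "\<Sum>v\<in>ends. card (pn v) - 1" and ?y = "\<Sum>v\<in>inner. card (pn v)"
  have cnt: "2 * lap_mult n E \<mu> + 5 = 2 * card ends + card inner + ?x + ?y"
    using card_vertices n by simp
  have i1: "1 \<le> card inner" using inner_nonempty by (simp add: Suc_le_eq card_gt_0_iff)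
  have "card ends = lap_mult n E \<mu> + 2 \<or> card ends = lap_mult n E \<mu> + 1"
    using cnt i1 mult_less_card_ends by linarith
  moreover have False if q: "card ends = lap_mult n E \<mu> + 2"
  proof -
    have i: "card inner = 1" and x: "?x = 0" using cnt i1 q by linarith+
    then have "\<forall>u\<in>ends. card (pn u) - 1 = 0" by simp
    then have "card (pn u) = 1" if "u \<in> ends" for u using ends_pn[OF that] that by fastforce
    then show False using i single_inner_not_all_legs[OF _ q] by (metis card_1_singletonE)
  qed
  ultimately have q: "card ends = lap_mult n E \<mu> + 1" by blast
  then have tot: "card inner + ?x + ?y = 3" using cnt by simp
  consider "card inner = 1" | "card inner = 2" | "card inner = 3" using tot i1 by linarith
  then show thesis
  proof cases
    case 1
    then obtain c where c: "inner = {c}" by (rule card_1_singletonE)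
    then have "?x + card (pn c) = 2" using tot by simp
    note max = single_inner_max[OF c q this]
    show thesis by (rule that[OF c q max(1) single_inner_cn[OF c] max(2,3)])
  next
    case 2
    then obtain x y where xy: "inner = {x, y}" "x \<noteq> y" by (auto simp: card_2_iff)
    have "?x + ?y = 1" using tot 2 by linarith
    then show thesis using no_two_inner[OF xy q] by blast
  next
    case 3
    then have "?x = 0" "?y = 0" using tot by auto
    then have "\<forall>u\<in>ends. card (pn u) - 1 = 0" by simp
    then have "card (pn u) = 1" if "u \<in> ends" for u using ends_pn[OF that] that by fastforce
    moreover have "card (pn v) = 0" if "v \<in> inner" for v using \<open>?y = 0\<close> that by simp
    ultimately show thesis using no_three_inner[OF 3 q] by blast
  qed
qed

end

section \<open>Conjugate eigenvalues\<close>

text \<open>For \<open>x = a / b\<close> in lowest terms,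
  \<open>a * a - 3 * a * b + b * b = 0\<close> makes both \<open>a\<close> and \<open>b\<close>
  even.\<close>

lemma rat_no_golden_root: "(x :: rat)\<^sup>2 - 3 * x + 1 \<noteq> 0"
proof
  assume eq: "x\<^sup>2 - 3 * x + 1 = 0"
  obtain a b where ab: "quotient_of x = (a, b)" by fastforce
  have b: "b > 0" and cop: "coprime a b" and x: "x = rat_of_int a / rat_of_int b"
    using quotient_of_denom_pos[OF ab] quotient_of_coprime[OF ab] quotient_of_div[OF ab] by auto
  have "rat_of_int b * rat_of_int b * (x\<^sup>2 - 3 * x + 1) = rat_of_int (a * a - 3 * a * b + b * b)"
    using b unfolding x by (simp add: field_simps power2_eq_square)
  then have "rat_of_int (a * a - 3 * a * b + b * b) = 0" using eq by simp
  then have "a * a - 3 * a * b + b * b = 0" by (simp only: of_int_eq_0_iff)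
  then have "even (a * a - 3 * a * b + b * b)" by simp
  then have "even a \<and> even b" by auto
  then have "2 dvd gcd a b" by simp
  then show False using cop by simp
qed

lemma golden_irreducible: "irreducible [:1, -3, 1 :: rat:]"
proof -
  have "irreducible\<^sub>d [:1, -3, 1 :: rat:]"
  proof (rule irreducible\<^sub>dI)
    fix q r :: "rat poly"
    assume deg: "0 < Polynomial.degree q" "Polynomial.degree q < Polynomial.degree [:1, -3, 1 :: rat:]"
      and qr: "[:1, -3, 1:] = q * r"
    have d: "Polynomial.degree q = 1" using deg by simp
    obtain c e where q: "q = [:c, e:]" using degree1_coeffs[OF d] by metis
    have e: "e \<noteq> 0" using d unfolding q by (auto split: if_splits)
    have "poly q (- c / e) = 0" using e unfolding q by simp
    then have "poly [:1, -3, 1:] (- c / e) = 0" unfolding qr by simp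
    then show False using rat_no_golden_root[of "- c / e"] by (simp add: power2_eq_square algebra_simps)
  qed simp
  then show ?thesis by simp
qed

text \<open>The quadratic is the minimal polynomial of \<open>\<mu>\<close>: the remainder of
  \<open>p\<close> has degree at most one and vanishes at \<open>\<mu>\<close>, which is
  irrational.\<close>

lemma golden_dvd:
  fixes p :: "rat poly" and \<mu> :: real
  assumes mu: "\<mu>\<^sup>2 - 3 * \<mu> + 1 = 0" and root: "poly (map_poly of_rat p) \<mu> = 0"
  shows "[:1, -3, 1:] dvd p"
proof -
  let ?q = "[:1, -3, 1 :: rat:]"
  define r where "r = p mod ?q"
  have "Polynomial.degree r < Polynomial.degree ?q \<or> r = 0"
    unfolding r_def using degree_mod_less[of ?q p] by auto
  then have "Polynomial.degree r \<le> 1" by auto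
  then have "r = [:coeff r 0, coeff r 1:]"
    by (intro poly_eqI) (auto simp: coeff_pCons coeff_eq_0 split: nat.split)
  then obtain a b where r: "r = [:a, b:]" by blast
  interpret hom: map_poly_comm_ring_hom "of_rat :: rat \<Rightarrow> real" ..
  have "p = ?q * (p div ?q) + r" unfolding r_def by (rule mult_div_mod_eq[symmetric])
  then have "map_poly of_rat p = map_poly of_rat ?q * map_poly of_rat (p div ?q) + (map_poly of_rat r :: real poly)"
    by (metis hom.hom_add hom.hom_mult)
  then have "poly (map_poly of_rat p) \<mu>
      = poly (map_poly of_rat ?q) \<mu> * poly (map_poly of_rat (p div ?q)) \<mu> + poly (map_poly of_rat r) \<mu>"
    by (simp only: poly_add poly_mult)
  moreover have "poly (map_poly of_rat ?q) \<mu> = 0"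
    using mu by (simp add: of_rat_hom.map_poly_pCons_hom power2_eq_square algebra_simps)
  ultimately have "poly (map_poly of_rat r) \<mu> = 0" unfolding root by (simp only: mult_zero_left add_0_left)
  then have ab: "of_rat a + \<mu> * of_rat b = 0" unfolding r by (simp add: of_rat_hom.map_poly_pCons_hom)
  have "b = 0"
  proof (rule ccontr)
    assume b: "b \<noteq> 0"
    define x where "x = - a / b"
    have x: "\<mu> = of_rat x" using ab b by (simp add: x_def of_rat_divide of_rat_minus field_simps)
    have "of_rat (x\<^sup>2 - 3 * x + 1) = (0 :: real)"
      using mu unfolding x by (simp add: of_rat_add of_rat_diff of_rat_mult of_rat_power)
    then show False using rat_no_golden_root[of x] of_rat_eq_0_iff by blast
  qed
  then have "r = 0" using ab r by simp
  then show ?thesis unfolding r_def by (simp add: mod_eq_0_iff_dvd)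
qed

text \<open>Both numbers are roots of the irreducible \<open>[:1, -3, 1:]\<close>, which divides the
  rational characteristic polynomial as soon as \<open>\<mu>\<close> is an eigenvalue.\<close>

lemma lap_conjugate_golden:
  assumes sg: "simple_graph n E" and mu: "\<mu>\<^sup>2 - 3 * \<mu> + 1 = 0" and nu: "\<nu>\<^sup>2 - 3 * \<nu> + 1 = 0"
    and mult: "0 < lap_mult n E \<mu>"
  shows "lap_conjugate n E \<mu> \<nu>"
proof -
  let ?L = "laplacian n E :: rat mat"
  have "map_mat of_rat ?L = (laplacian n E :: real mat)"
    unfolding laplacian_def by (intro eq_matI) auto
  moreover have "char_poly (map_mat real_of_rat ?L) = map_poly of_rat (char_poly ?L)"
    by (rule of_rat_hom.char_poly_hom[OF laplacian_carrier])
  ultimately have "char_poly (laplacian n E :: real mat) = map_poly of_rat (char_poly ?L)" by simp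
  moreover have "poly (char_poly (laplacian n E :: real mat)) \<mu> = 0"
    using mult unfolding lap_mult_def by (metis less_irrefl order_root order_0I)
  ultimately have "[:1, -3, 1:] dvd char_poly ?L" using golden_dvd[OF mu] by simp
  moreover have "poly (map_poly of_rat [:1, -3, 1 :: rat:]) x = x\<^sup>2 - 3 * x + 1" for x :: real
    by (simp add: of_rat_hom.map_poly_pCons_hom power2_eq_square algebra_simps)
  ultimately show ?thesis unfolding lap_conjugate_def using golden_irreducible mu nu by metis
qed

lemma golden_roots: "\<mu>\<^sup>2 - 3 * \<mu> + 1 = 0 \<longleftrightarrow> \<mu> = (3 + sqrt 5) / 2 \<or> \<mu> = (3 - sqrt 5) / 2" for \<mu> :: real
proof -
  have "\<mu>\<^sup>2 - 3 * \<mu> + 1 = (\<mu> - (3 + sqrt 5) / 2) * (\<mu> - (3 - sqrt 5) / 2)"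
    by (simp add: field_simps power2_eq_square)
  then show ?thesis by auto
qed

section \<open>Spiders\<close>

lemma spider_simple: "k \<le> s \<Longrightarrow> simple_graph (s + k + 1) (spider_edge s k)"
  by (auto simp: simple_graph_def spider_edge_def)

lemma spider_neighbours:
  assumes "k \<le> s"
  shows "{j. j < s + k + 1 \<and> spider_edge s k 0 j} = {1..s}"
    "1 \<le> i \<Longrightarrow> i \<le> k \<Longrightarrow> {j. j < s + k + 1 \<and> spider_edge s k i j} = {0, s + i}"
    "k < i \<Longrightarrow> i \<le> s \<Longrightarrow> {j. j < s + k + 1 \<and> spider_edge s k i j} = {0}"
    "s < i \<Longrightarrow> i \<le> s + k \<Longrightarrow> {j. j < s + k + 1 \<and> spider_edge s k i j} = {i - s}"
  using assms by (auto simp: spider_edge_def)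

lemma spider_degree:
  assumes "k \<le> s"
  shows "degree (s + k + 1) (spider_edge s k) 0 = s"
    "1 \<le> i \<Longrightarrow> i \<le> k \<Longrightarrow> degree (s + k + 1) (spider_edge s k) i = 2"
    "k < i \<Longrightarrow> i \<le> s + k \<Longrightarrow> degree (s + k + 1) (spider_edge s k) i = 1"
proof -
  show "degree (s + k + 1) (spider_edge s k) 0 = s" 
    unfolding degree_def spider_neighbours(1)[OF assms] by simp
  show "degree (s + k + 1) (spider_edge s k) i = 2" if "1 \<le> i" "i \<le> k"
    unfolding degree_def spider_neighbours(2)[OF assms that] using that assms by simp
  show "degree (s + k + 1) (spider_edge s k) i = 1" if "k < i" "i \<le> s + k"
  proof (cases "i \<le> s")
    case True
    show ?thesis unfolding degree_def spider_neighbours(3)[OF assms that(1) True] by simp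
  next
    case False
    then have "s < i" by simp
    show ?thesis unfolding degree_def spider_neighbours(4)[OF assms \<open>s < i\<close> that(2)] by simp
  qed
qed

text \<open>The leaves are the vertices above \<open>k\<close> and their neighbours are at most
  \<open>k\<close>; \<open>2 \<le> s\<close> keeps the centre from being a leaf.\<close>

lemma spider_core_graph:
  fixes \<mu> :: real
  assumes "k \<le> s" "2 \<le> s" "\<mu> \<noteq> 1"
  shows "core_graph (s + k + 1) (spider_edge s k) \<mu>"
proof
  show "simple_graph (s + k + 1) (spider_edge s k)" by (rule spider_simple[OF assms(1)])
  show "degree (s + k + 1) (spider_edge s k) w \<noteq> 1"
    if e: "spider_edge s k v w" and d: "degree (s + k + 1) (spider_edge s k) v = 1" for v w
  proof -
    have "k < v"
    proof (rule ccontr)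
      assume "\<not> k < v"
      then have "v = 0 \<or> 1 \<le> v \<and> v \<le> k" by auto
      then show False
        using d spider_degree(1)[OF assms(1)] spider_degree(2)[OF assms(1), of v] assms(2) by auto
    qed
    then have "w = 0 \<or> 1 \<le> w \<and> w \<le> k" using e assms by (auto simp: spider_edge_def)
    then show ?thesis using spider_degree(1,2)[OF assms(1)] assms(2) by auto
  qed
qed (rule assms(3))

lemma spider_core_sets:
  fixes \<mu> :: real
  assumes k: "k \<le> s" "2 \<le> s" and mu: "\<mu> \<noteq> 1"
  shows "core_graph.core (s + k + 1) (spider_edge s k) = {..k}"
    "core_graph.cn (s + k + 1) (spider_edge s k) 0 = {1..k}"
    "card (core_graph.pn (s + k + 1) (spider_edge s k) 0) = s - k"
    "1 \<le> i \<Longrightarrow> i \<le> k \<Longrightarrow> core_graph.cn (s + k + 1) (spider_edge s k) i = {0}"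
    "1 \<le> i \<Longrightarrow> i \<le> k \<Longrightarrow> card (core_graph.pn (s + k + 1) (spider_edge s k) i) = 1"
proof -
  interpret core_graph "s + k + 1" "spider_edge s k" \<mu> by (rule spider_core_graph[OF assms])
  note deg = spider_degree[OF k(1)]
  have deg_iff: "degree (s + k + 1) (spider_edge s k) i = 1 \<longleftrightarrow> k < i" if "i < s + k + 1" for i
  proof -
    consider "i = 0" | "1 \<le> i" "i \<le> k" | "k < i" by linarith
    then show ?thesis using deg(1) deg(2)[of i] deg(3)[of i] k(2) that by cases auto
  qed
  show c: "core = {..k}" unfolding core_def using deg_iff by force
  have l: "leaves = {k+1..s+k}" unfolding leaves_def using deg_iff by force
  show "cn 0 = {1..k}" unfolding cn_def c using k(1) by (auto simp: spider_edge_def)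
  have "pn 0 = {k+1..s}" unfolding pn_def l using k(1) by (auto simp: spider_edge_def)
  then show "card (pn 0) = s - k" by simp
  show "cn i = {0}" if "1 \<le> i" "i \<le> k" unfolding cn_def c using that k(1) by (auto simp: spider_edge_def)
  have "pn i = {s + i}" if "1 \<le> i" "i \<le> k" unfolding pn_def l using that k(1) by (auto simp: spider_edge_def)
  then show "card (pn i) = 1" if "1 \<le> i" "i \<le> k" using that by simp
qed

section \<open>Eigenvalues of spiders\<close>

lemma spider_eigfun:
  assumes k: "k \<le> s" "2 \<le> s" and mu: "\<mu> \<noteq> 1" and f: "lap_eigfun (s + k + 1) (spider_edge s k) \<mu> f"
  shows "i \<in> {1..k} \<Longrightarrow> (2 - \<mu> - 1 / (1 - \<mu>)) * f i = f 0"
    "(real s - \<mu> - real (s - k) / (1 - \<mu>)) * f 0 = (\<Sum>i=1..k. f i)"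
    "f 0 = 0 \<Longrightarrow> (\<And>i. i \<in> {1..k} \<Longrightarrow> f i = 0) \<Longrightarrow> j < s + k + 1 \<Longrightarrow> f j = 0"
proof -
  interpret core_graph "s + k + 1" "spider_edge s k" \<mu> by (rule spider_core_graph[OF k mu])
  note sets = spider_core_sets[OF k mu]
  show "(2 - \<mu> - 1 / (1 - \<mu>)) * f i = f 0" if "i \<in> {1..k}"
    using core_eq[OF f, of i] sets(1) sets(4,5)[of i] that by (simp add: leg_coeff_def)
  show "(real s - \<mu> - real (s - k) / (1 - \<mu>)) * f 0 = (\<Sum>i=1..k. f i)"
    using core_eq[OF f, of 0] sets(1-3) k(1) by (simp add: leg_coeff_def of_nat_diff)
  show "f j = 0" if "f 0 = 0" "\<And>i. i \<in> {1..k} \<Longrightarrow> f i = 0" "j < s + k + 1"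
  proof (rule eigfun_zero_if_core_zero[OF f _ that(3)])
    show "f v = 0" if "v \<in> core" for v
      using that \<open>f 0 = 0\<close> \<open>\<And>i. i \<in> {1..k} \<Longrightarrow> f i = 0\<close> unfolding sets(1) by (cases "v = 0") auto
  qed
qed

text \<open>The antisymmetric functions of \<open>card_legs_le\<close> give one bound. For the
  other, \<open>k - 1\<close> leg vertices form a determining set: the leg equation makes the centre
  vanish, and the equation at the centre then makes the last leg vanish.\<close>

lemma lap_mult_spider_golden:
  assumes k: "k \<le> s" "2 \<le> k" and mu: "\<mu>\<^sup>2 - 3 * \<mu> + 1 = 0"
  shows "lap_mult (s + k + 1) (spider_edge s k) \<mu> = k - 1"
proof -
  have mu1: "\<mu> \<noteq> 1" using mu by auto
  have s2: "2 \<le> s" using k by simp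
  interpret core_graph "s + k + 1" "spider_edge s k" \<mu> by (rule spider_core_graph[OF k(1) s2 mu1])
  note sets = spider_core_sets[OF k(1) s2 mu1]
  have golden: "leg_coeff 1 1 = 0" using mu by (simp only: leg_coeff_1_1_zero_iff)
  then have g: "2 - \<mu> - 1 / (1 - \<mu>) = 0" by (simp add: leg_coeff_def)
  have "card {1..k} \<le> lap_mult (s + k + 1) (spider_edge s k) \<mu> + 1"
    by (rule card_legs_le[of _ 0]) (use sets golden in auto)
  moreover have "lap_mult (s + k + 1) (spider_edge s k) \<mu> \<le> k - 1"
  proof (rule ccontr)
    assume "\<not> ?thesis"
    then have lt: "card {1..<k} < lap_mult (s + k + 1) (spider_edge s k) \<mu>" by simp
    have "{1..<k} \<subseteq> {..<s + k + 1}" by auto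
    then obtain f where f: "lap_eigfun (s + k + 1) (spider_edge s k) \<mu> f" "\<exists>i<s + k + 1. f i \<noteq> 0"
      "\<And>i. i \<in> {1..<k} \<Longrightarrow> f i = 0"
      using eigfun_vanishing[OF simple _ lt] by blast
    note eqs = spider_eigfun[OF k(1) s2 mu1 f(1)]
    have f0: "f 0 = 0" using eqs(1)[of 1] g k by simp
    have "(\<Sum>i=1..k. f i) = f k" by (rule sum_eq_single) (use k f(3) in auto)
    then have "f k = 0" using eqs(2) f0 by simp
    then have "f i = 0" if "i \<in> {1..k}" for i using that f(3)[of i] by (cases "i = k") auto
    then show False using eqs(3) f0 f(2) by blast
  qed
  ultimately show ?thesis by simp
qed

lemma lap_mult_eq_0_if:
  assumes "simple_graph n E" "\<And>f i. lap_eigfun n E \<mu> f \<Longrightarrow> i < n \<Longrightarrow> f i = 0"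
  shows "lap_mult n E \<mu> = 0"
proof (rule ccontr)
  assume "lap_mult n E \<mu> \<noteq> 0"
  then have "card {} < lap_mult n E \<mu>" by simp
  then show False using eigfun_vanishing[OF assms(1), of "{}"] assms(2) by blast
qed

text \<open>The constant function is an eigenfunction, so the empty set is not determining.\<close>

lemma lap_mult_0_pos:
  assumes "simple_graph n E" "0 < n"
  shows "0 < lap_mult n E 0"
proof (rule ccontr)
  assume "\<not> 0 < lap_mult n E 0"
  then have z: "lap_mult n E 0 = 0" by simp
  obtain S where S: "S \<subseteq> {..<n}" "card S = lap_mult n E 0"
    "\<And>f i. lap_eigfun n E 0 f \<Longrightarrow> (\<And>s. s \<in> S \<Longrightarrow> f s = 0) \<Longrightarrow> i < n \<Longrightarrow> f i = 0"
    using eigfun_determining_set[OF assms(1)] by blast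
  have "S = {}" using S(1,2) z finite_subset[OF S(1)] by simp
  moreover have "lap_eigfun n E 0 (\<lambda>_. 1)" by (simp add: lap_eigfun_def degree_def)
  ultimately show False using S(3)[of "\<lambda>_. 1" 0] assms(2) by simp
qed

text \<open>Below the smaller root the leg coefficient \<open>g\<close> is positive, so the leg
  values are \<open>f 0 / g\<close> and the equation at the centre becomes a polynomial condition on
  \<open>\<nu>\<close> unless \<open>f 0 = 0\<close>.\<close>

lemma spider_mult_below:
  fixes \<nu> :: real
  assumes k: "1 \<le> k" and nu: "\<nu> < (3 - sqrt 5) / 2" "\<nu> \<noteq> 0"
  shows "lap_mult (k + 2 + k + 1) (spider_edge (k + 2) k) \<nu> = 0"
proof (rule lap_mult_eq_0_if)
  show "simple_graph (k + 2 + k + 1) (spider_edge (k + 2) k)" by (rule spider_simple) simp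
  fix f i assume f: "lap_eigfun (k + 2 + k + 1) (spider_edge (k + 2) k) \<nu> f" and i: "i < k + 2 + k + 1"
  define r where "r = sqrt 5"
  have r: "1 \<le> r" "r * r = 5" by (simp_all add: r_def)
  have nur: "\<nu> < (3 - r) / 2" using nu(1) by (simp only: r_def)
  then have nu1: "\<nu> < 1" using r(1) by (simp add: field_simps)
  define t where "t = 1 - \<nu>"
  have t: "t > 0" "t \<noteq> 1" using nu1 nu(2) by (auto simp: t_def)
  have "\<nu>\<^sup>2 - 3 * \<nu> + 1 = (\<nu> - (3 + r) / 2) * (\<nu> - (3 - r) / 2)"
    using r(2) by (simp add: field_simps power2_eq_square)
  moreover have "\<dots> > 0" using nur r(1) by (intro mult_neg_neg) (auto simp: field_simps)
  ultimately have p: "t * t + t - 1 > 0" by (simp add: t_def algebra_simps power2_eq_square)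
  define g where "g = 1 + t - 1 / t"
  have gt: "g * t = t * t + t - 1" using t by (simp add: g_def field_simps)
  then have g: "g > 0" using p t by (metis zero_less_mult_pos2)
  have le: "k \<le> k + 2" "2 \<le> k + 2" by auto
  note eqs = spider_eigfun[OF le _ f]
  have leg: "g * f i = f 0" if "i \<in> {1..k}" for i
    using eqs(1)[OF _ that] nu1 by (simp add: g_def t_def)
  have mid: "(real k + 1 + t - 2 / t) * f 0 = (\<Sum>i=1..k. f i)"
    using eqs(2) nu1 by (simp add: t_def algebra_simps)
  have "f 0 = 0"
  proof (rule ccontr)
    assume f0: "f 0 \<noteq> 0"
    have "g * (\<Sum>i=1..k. f i) = (\<Sum>i=1..k. f 0)" using leg by (simp add: sum_distrib_left)
    then have "(g * (real k + 1 + t - 2 / t)) * f 0 = real k * f 0" unfolding mid[symmetric] by simp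
    then have "g * (real k + 1 + t - 2 / t) = real k" using f0 mult_right_cancel by blast
    moreover have "(g * t) * ((real k + 1 + t - 2 / t) * t) = g * (real k + 1 + t - 2 / t) * t * t"
      by (simp only: mult_ac)
    ultimately have "(g * t) * ((real k + 1 + t - 2 / t) * t) = real k * t * t" by simp
    moreover have "(real k + 1 + t - 2 / t) * t = real k * t + t + t * t - 2" using t by (simp add: field_simps)
    ultimately have eq: "(t * t + t - 1) * (real k * t + t + t * t - 2) = real k * t * t" using gt by simp
    \<comment> \<open>\<open>t = 1\<close>, that is \<open>\<nu> = 0\<close>, has to be a solution.
      Splitting it off rests on \<open>t * t + t - 2 = (t - 1) * (t + 2)\<close> and leaves a
      positive factor.\<close>
    have "(t * t + t - 1) * (real k * t + t + t * t - 2) - real k * t * t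
      = (t - 1) * (real k * t * (t + 1) + (t * t + t - 1) * (t + 2))"
      by (simp add: algebra_simps)
    then have "(t - 1) * (real k * t * (t + 1) + (t * t + t - 1) * (t + 2)) = 0" using eq by simp
    moreover have "real k * t * (t + 1) + (t * t + t - 1) * (t + 2) > 0"
      using p t by (intro add_nonneg_pos mult_nonneg_nonneg mult_pos_pos) auto
    ultimately show False using t(2) by simp
  qed
  moreover have "f i = 0" if "i \<in> {1..k}" for i using leg[OF that] \<open>f 0 = 0\<close> g by simp
  ultimately show "f i = 0" using eqs(3) nu1 i by simp
qed

text \<open>At 0 the leg coefficient is 1, so an eigenfunction that vanishes at the centre is zero,
  and one vertex is determining.\<close>

lemma spider_mult_0:
  assumes k: "1 \<le> k"
  shows "lap_mult (k + 2 + k + 1) (spider_edge (k + 2) k) 0 = 1"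
proof (rule ccontr)
  let ?n = "k + 2 + k + 1" and ?F = "spider_edge (k + 2) k"
  assume ne: "lap_mult ?n ?F 0 \<noteq> 1"
  have sg: "simple_graph ?n ?F" by (rule spider_simple) simp
  have "card {0::nat} < lap_mult ?n ?F 0" using ne lap_mult_0_pos[OF sg] by simp
  then obtain f where f: "lap_eigfun ?n ?F 0 f" "\<exists>i<?n. f i \<noteq> 0" "f 0 = 0"
    using eigfun_vanishing[OF sg, of "{0}"] by auto
  have le: "k \<le> k + 2" "2 \<le> k + 2" "(0::real) \<noteq> 1" by auto
  note eqs = spider_eigfun[OF le f(1)]
  have "f i = 0" if "i \<in> {1..k}" for i using eqs(1)[OF that] f(3) by simp
  then show False using eqs(3) f(2,3) by blast
qed

text \<open>0 occurs once, the smaller root occurs, and nothing else lies below it, so it stands at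
  index 1 of the sorted list.\<close>

lemma spider_alg_conn:
  assumes k: "2 \<le> k"
  shows "alg_conn (k + 2 + k + 1) (spider_edge (k + 2) k) = (3 - sqrt 5) / 2"
proof -
  let ?n = "k + 2 + k + 1" and ?F = "spider_edge (k + 2) k" and ?a = "(3 - sqrt 5) / 2 :: real"
  define M where "M = proots (char_poly (laplacian ?n ?F :: real mat))"
  define xs where "xs = sorted_list_of_multiset M"
  have "char_poly (laplacian ?n ?F :: real mat) \<noteq> 0"
    by (metis coeff_0 degree_monic_char_poly laplacian_carrier zero_neq_one)
  then have count: "count M x = lap_mult ?n ?F x" for x unfolding M_def lap_mult_def by simp
  have a: "?a > 0"
  proof -
    have "sqrt 5 < sqrt 9" by (intro real_sqrt_less_mono) simp
    then show ?thesis by simp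
  qed
  have "?a\<^sup>2 - 3 * ?a + 1 = 0" using golden_roots by blast
  then have "0 < lap_mult ?n ?F ?a" using lap_mult_spider_golden[of k "k + 2" ?a] k by simp
  then have aM: "?a \<in># M" using count by (simp add: count_greater_zero_iff[symmetric] del: count_greater_zero_iff)
  have M0: "count M 0 = 1" using count spider_mult_0 k by simp
  have low: "x = 0 \<or> ?a \<le> x" if "x \<in># M" for x
  proof (rule ccontr)
    assume "\<not> (x = 0 \<or> ?a \<le> x)"
    then have "count M x = 0" using spider_mult_below[of k x] count k by simp
    then show False using that by (simp add: count_eq_zero_iff)
  qed
  have xs: "mset xs = M" "sorted xs" unfolding xs_def by auto
  have "0 \<in> set xs" using M0 xs(1) by (metis count_eq_zero_iff set_mset_mset zero_neq_one)
  then obtain y ys where y: "xs = y # ys" by (cases xs) auto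
  have "y \<le> 0" using \<open>0 \<in> set xs\<close> xs(2) unfolding y by auto
  moreover have "y \<in># M" using xs(1) unfolding y by auto
  ultimately have y0: "y = 0" using low[of y] a by linarith
  have "count (mset ys) 0 = 0" using M0 xs(1) unfolding y y0 by auto
  then have "0 \<notin> set ys" by (simp add: count_eq_zero_iff)
  have "?a \<in> set ys" using aM xs(1) a y y0 by (metis less_irrefl set_ConsD set_mset_mset)
  then obtain z zs where z: "ys = z # zs" by (cases ys) auto
  have "z \<le> ?a" using \<open>?a \<in> set ys\<close> xs(2) unfolding y z by auto
  moreover have "z \<in># M" "z \<noteq> 0" using xs(1) \<open>0 \<notin> set ys\<close> unfolding y z by auto
  ultimately have "z = ?a" using low[of z] by linarith
  moreover have "alg_conn ?n ?F = xs ! 1"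
    unfolding alg_conn_def lap_spectrum_def xs_def M_def ..
  ultimately show ?thesis using y z by simp
qed

section \<open>Recognising a spider from its core\<close>

context core_graph
begin

text \<open>The vertices of \<open>Q\<close> become the extended rays and the leaves at
  \<open>c\<close> the plain ones, whence \<open>k + a\<close> rays in all.\<close>

lemma graph_iso_spider:
  assumes core: "core = insert c Q" "c \<notin> Q" and cn: "\<And>q. q \<in> Q \<Longrightarrow> cn q = {c}"
    and one: "\<And>q. q \<in> Q \<Longrightarrow> card (pn q) = 1"
  defines "k \<equiv> card Q" and "a \<equiv> card (pn c)"
  shows "graph_iso n E (k + a + k + 1) (spider_edge (k + a) k)"
proof -
  have finQ: "finite Q" using finite_sets(1) unfolding core(1) by simp
  obtain h where h: "bij_betw h Q {1..k}"
  proof -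
    have "card Q = card {1..k}" unfolding k_def by simp
    from finite_same_card_bij[OF finQ finite_atLeastAtMost this] show thesis using that by blast
  qed
  obtain p where p: "bij_betw p (pn c) {k+1..k+a}"
  proof -
    have "card (pn c) = card {k+1..k+a}" unfolding a_def by simp
    from finite_same_card_bij[OF finite_sets(4) finite_atLeastAtMost this] show thesis using that by blast
  qed
  have hQ: "1 \<le> h q \<and> h q \<le> k" if "q \<in> Q" for q using bij_betwE[OF h] that by auto
  have pc: "k + 1 \<le> p l \<and> p l \<le> k + a" if "l \<in> pn c" for l using bij_betwE[OF p] that by auto
  have hinj: "h q = h q' \<longleftrightarrow> q = q'" if "q \<in> Q" "q' \<in> Q" for q q'
    using bij_betw_imp_inj_on[OF h] that by (auto simp: inj_on_eq_iff)
  have pinj: "p l = p l' \<longleftrightarrow> l = l'" if "l \<in> pn c" "l' \<in> pn c" for l l'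
    using bij_betw_imp_inj_on[OF p] that by (auto simp: inj_on_eq_iff)
  have stem_inj: "l = l'" if l: "l \<in> leaves" "l' \<in> leaves" "stem l \<in> Q" "stem l = stem l'" for l l'
  proof -
    obtain t where "pn (stem l) = {t}" using one[OF l(3)] by (rule card_1_singletonE)
    moreover have "l \<in> pn (stem l)" "l' \<in> pn (stem l)" using l by (auto simp: mem_pn_iff)
    ultimately show ?thesis by simp
  qed
  \<comment> \<open>The branches have the images 0, \<open>1..k\<close>, \<open>k+1..k+a\<close> and
    \<open>k+a+1..k+a+k\<close>; the last follows the convention of \<open>spider_edge\<close> that
    \<open>s + i\<close> extends ray \<open>i\<close>.\<close>
  define f where "f v = (if v = c then 0 else if v \<in> Q then h v else if stem v = c then p v
    else k + a + h (stem v))" for v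
  have nl: "c \<notin> leaves" "\<And>q. q \<in> Q \<Longrightarrow> q \<notin> leaves" using core_Int_leaves unfolding core(1) by auto
  have f_c: "f c = 0" by (simp add: f_def)
  have f_Q: "f q = h q" if "q \<in> Q" for q using that core(2) by (auto simp: f_def)
  have f_pc: "f l = p l" if "l \<in> pn c" for l using that nl by (auto simp: f_def mem_pn_iff)
  have f_lQ: "f l = k + a + h (stem l)" if "l \<in> leaves" "stem l \<in> Q" for l
    using that nl core(2) by (auto simp: f_def)
  have cases: thesis if "v < n" "v = c \<Longrightarrow> thesis" "v \<in> Q \<Longrightarrow> thesis" "v \<in> pn c \<Longrightarrow> thesis"
    "v \<in> leaves \<Longrightarrow> stem v \<in> Q \<Longrightarrow> thesis" for v thesis
  proof -
    have "v \<in> core \<or> v \<in> leaves" using core_Un_leaves that(1) by blast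
    then show ?thesis using that(2-5) stem_core[of v] unfolding core(1) by (auto simp: mem_pn_iff)
  qed
  have inj: "inj_on f {0..<n}"
  proof (rule inj_onI)
    fix x y assume "x \<in> {0..<n}" "y \<in> {0..<n}" and eq: "f x = f y"
    then have xy: "x < n" "y < n" by auto
    show "x = y"
      by (rule cases[OF xy(1)]; rule cases[OF xy(2)])
        (use eq hQ[of x] hQ[of y] hQ[of "stem x"] hQ[of "stem y"] pc[of x] pc[of y] hinj[of x y]
          hinj[of "stem x" "stem y"] pinj[of x y] stem_inj[of x y]
         in \<open>auto simp: f_c f_Q f_pc f_lQ\<close>)
  qed
  have "n = k + a + k + 1"
  proof -
    have "n = card (core \<union> leaves)" by (simp add: core_Un_leaves)
    also have "\<dots> = card core + card leaves" by (rule card_Un_disjoint) (auto simp: core_Int_leaves)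
    also have "card leaves = a + k" 
      unfolding card_leaves core(1) using finQ core(2) one by (simp add: a_def k_def)
    also have "card core = k + 1" unfolding core(1) using finQ core(2) by (simp add: k_def)
    finally show ?thesis by simp
  qed
  moreover have "f ` {0..<n} \<subseteq> {0..<k + a + k + 1}"
  proof
    fix y assume "y \<in> f ` {0..<n}"
    then obtain v where v: "v < n" "y = f v" by auto
    show "y \<in> {0..<k + a + k + 1}"
      unfolding v(2) by (rule cases[OF v(1)]) (use hQ[of v] hQ[of "stem v"] pc[of v] in \<open>auto simp: f_c f_Q f_pc f_lQ\<close>)
  qed
  ultimately have "f ` {0..<n} = {0..<k + a + k + 1}"
    using inj by (intro card_subset_eq) (auto simp: card_image)
  then have bij: "bij_betw f {0..<n} {0..<k + a + k + 1}" using inj by (simp add: bij_betw_def)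
  have Ecc: "\<not> E c c" using edgeD(3) by blast
  have EcQ: "E c q" "E q c" if "q \<in> Q" for q
    using cn[OF that] edgeD(4)[of q c] by (auto simp: cn_def)
  have EQQ: "\<not> E q q'" if "q \<in> Q" "q' \<in> Q" for q q'
    using cn[OF that(1)] that core unfolding cn_def by auto
  have El: "E l w \<longleftrightarrow> w = stem l" "E w l \<longleftrightarrow> w = stem l" if "l \<in> leaves" for l w
    using stem_eq[OF that, of w] edgeD(4)[of l w] edgeD(4)[of w l] by auto
  have pn_leaf: "l \<in> leaves" "stem l = c" if "l \<in> pn c" for l using that by (auto simp: mem_pn_iff)
  have "E x y \<longleftrightarrow> spider_edge (k + a) k (f x) (f y)" if xy: "x < n" "y < n" for x y
  proof (rule cases[OF xy(1)]; rule cases[OF xy(2)])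
    assume "x = c" "y = c"
    then show ?thesis using Ecc by (simp add: f_c spider_edge_def)
  next
    assume "x = c" "y \<in> Q"
    then show ?thesis using EcQ hQ[of y] by (simp add: f_c f_Q spider_edge_def)
  next
    assume "x = c" "y \<in> pn c"
    then show ?thesis using El pn_leaf[of y] pc[of y] by (simp add: f_c f_pc spider_edge_def)
  next
    assume "x = c" "y \<in> leaves" "stem y \<in> Q"
    then show ?thesis using El[of y x] core(2) hQ[of "stem y"] by (auto simp: f_c f_lQ spider_edge_def)
  next
    assume "x \<in> Q" "y = c"
    then show ?thesis using EcQ hQ[of x] by (simp add: f_c f_Q spider_edge_def)
  next
    assume "x \<in> Q" "y \<in> Q"
    then show ?thesis using EQQ hQ[of x] hQ[of y] by (auto simp: f_Q spider_edge_def)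
  next
    assume "x \<in> Q" "y \<in> pn c"
    then show ?thesis using El[of y x] pn_leaf[of y] core(2) hQ[of x] pc[of y] 
      by (auto simp: f_Q f_pc spider_edge_def)
  next
    assume a: "x \<in> Q" "y \<in> leaves" "stem y \<in> Q"
    have "E x y \<longleftrightarrow> h x = h (stem y)" using El(2)[OF a(2), of x] hinj[OF a(1,3)] by simp
    then show ?thesis using hQ[OF a(1)] hQ[OF a(3)]
      unfolding f_Q[OF a(1)] f_lQ[OF a(2,3)] spider_edge_def by auto
  next
    assume "x \<in> pn c" "y = c"
    then show ?thesis using El pn_leaf[of x] pc[of x] by (simp add: f_c f_pc spider_edge_def)
  next
    assume "x \<in> pn c" "y \<in> Q"
    then show ?thesis using El[of x y] pn_leaf[of x] core(2) hQ[of y] pc[of x] 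
      by (auto simp: f_Q f_pc spider_edge_def)
  next
    assume "x \<in> pn c" "y \<in> pn c"
    then show ?thesis using El[of x y] pn_leaf[of x] pn_leaf[of y] nl(1) pc[of x] pc[of y] 
      by (auto simp: f_pc spider_edge_def)
  next
    assume "x \<in> pn c" "y \<in> leaves" "stem y \<in> Q"
    then show ?thesis using El[of x y] pn_leaf[of x] nl pc[of x] hQ[of "stem y"] 
      by (auto simp: f_pc f_lQ spider_edge_def)
  next
    assume "x \<in> leaves" "stem x \<in> Q" "y = c"
    then show ?thesis using El[of x y] core(2) hQ[of "stem x"] by (auto simp: f_c f_lQ spider_edge_def)
  next
    assume a: "x \<in> leaves" "stem x \<in> Q" "y \<in> Q"
    have "E x y \<longleftrightarrow> h y = h (stem x)" using El(1)[OF a(1), of y] hinj[OF a(3,2)] by simp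
    then show ?thesis using hQ[OF a(3)] hQ[OF a(2)]
      unfolding f_Q[OF a(3)] f_lQ[OF a(1,2)] spider_edge_def by auto
  next
    assume "x \<in> leaves" "stem x \<in> Q" "y \<in> pn c"
    then show ?thesis using El[of x y] pn_leaf[of y] nl pc[of y] hQ[of "stem x"] 
      by (auto simp: f_pc f_lQ spider_edge_def)
  next
    assume "x \<in> leaves" "stem x \<in> Q" "y \<in> leaves" "stem y \<in> Q"
    then show ?thesis using El[of x y] nl(2)[of "stem y"] nl(2)[of "stem x"] hQ[of "stem x"] hQ[of "stem y"] by (auto simp: f_lQ spider_edge_def)
  qed
  with bij show ?thesis unfolding graph_iso_def by blast
qed

end

theorem theorem4p6:
  fixes n :: nat and E :: "nat \<Rightarrow> nat \<Rightarrow> bool" and \<mu> :: real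
  assumes "is_tree n E" and "n \<ge> 9"
    and "eigenvalue (laplacian n E :: real mat) \<mu>" and "\<mu> \<noteq> 1"
  shows "(real (lap_mult n E \<mu>) = (real n - 1) / 2 - 2 \<longleftrightarrow>
            (graph_iso n E ((n - 1) div 2 + 1 + ((n - 1) div 2 - 1) + 1)
                 (spider_edge ((n - 1) div 2 + 1) ((n - 1) div 2 - 1))
             \<and> (\<mu> = (3 + sqrt 5) / 2 \<or> \<mu> = (3 - sqrt 5) / 2)))
       \<and> (real (lap_mult n E \<mu>) = (real n - 1) / 2 - 2 \<longrightarrow>
            (\<mu> = alg_conn n E \<or> lap_conjugate n E \<mu> (alg_conn n E)))"
proof -
  define m where "m = (n - 1) div 2"
  have sg: "simple_graph n E" using assms(1) by (simp add: is_tree_def)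
  have m4: "4 \<le> m" using assms(2) by (simp add: m_def)
  \<comment> \<open>The spider has \<open>k\<close> extended rays and two plain ones, the two leaves
    at the centre in \<open>extremal_structure\<close>.\<close>
  define k where "k = m - 1"
  have k: "m + 1 = k + 2" "m - 1 = k" "3 \<le> k" using m4 by (auto simp: k_def)
  have sgF: "simple_graph (k + 2 + k + 1) (spider_edge (k + 2) k)" by (rule spider_simple) simp
  have fwd: "graph_iso n E (k + 2 + k + 1) (spider_edge (k + 2) k) \<and> \<mu>\<^sup>2 - 3 * \<mu> + 1 = 0"
    if mult: "real (lap_mult n E \<mu>) = (real n - 1) / 2 - 2"
  proof -
    \<comment> \<open>The equation over the reals forces \<open>n\<close> to be odd, which makes
      \<open>(n - 1) div 2\<close> exact.\<close>
    have "real (2 * lap_mult n E \<mu> + 5) = 2 * ((real n - 1) / 2 - 2) + 5" by (simp add: mult[symmetric])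
    also have "\<dots> = real n" by (simp add: field_simps)
    finally have "real n = real (2 * lap_mult n E \<mu> + 5)" by (rule sym)
    then have n: "n = 2 * lap_mult n E \<mu> + 5" by (simp only: of_nat_eq_iff)
    interpret core_graph n E \<mu> using tree_core_graph[OF assms(1) _ assms(4)] assms(2) by simp
    interpret tree_eigenvalue n E \<mu>
      by unfold_locales (use assms(1,2) n in auto)
    obtain c where c: "inner = {c}" "card ends = lap_mult n E \<mu> + 1" "leg_coeff 1 1 = 0"
      "\<And>u. u \<in> ends \<Longrightarrow> cn u = {c}" "\<And>u. u \<in> ends \<Longrightarrow> card (pn u) = 1" "card (pn c) = 2"
      using extremal_structure[OF n] by blast
    have "core = insert c ends" "c \<notin> ends" using core_split c(1) by auto
    note iso = graph_iso_spider[OF this c(4,5)]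
    have "card ends = k" using n c(2) m4 by (simp add: k_def m_def)
    then show ?thesis using iso c(3,6) leg_coeff_1_1_zero_iff by simp
  qed
  have bwd: "real (lap_mult n E \<mu>) = (real n - 1) / 2 - 2 \<and> alg_conn n E = (3 - sqrt 5) / 2
      \<and> lap_mult n E \<mu> = k - 1"
    if iso: "graph_iso n E (k + 2 + k + 1) (spider_edge (k + 2) k)" and mu: "\<mu>\<^sup>2 - 3 * \<mu> + 1 = 0"
  proof -
    have "lap_mult n E \<mu> = k - 1"
      using lap_mult_iso[OF sg sgF iso] lap_mult_spider_golden[of k "k + 2" \<mu>] mu k(3) by simp
    moreover have "n = 2 * k + 3"
    proof -
      obtain f where "bij_betw f {0..<n} {0..<k + 2 + k + 1}" using iso by (auto simp: graph_iso_def)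
      then have "card {0..<n} = card {0..<k + 2 + k + 1}" by (rule bij_betw_same_card)
      then show ?thesis by simp
    qed
    moreover have "alg_conn n E = (3 - sqrt 5) / 2"
      using alg_conn_iso[OF sg sgF iso] spider_alg_conn[of k] k(3) by simp
    ultimately show ?thesis using k(3) by (simp add: of_nat_diff)
  qed
  \<comment> \<open>Equal or not, two roots of the quadratic are conjugate, so the second disjunct
    always holds.\<close>
  have conj: "lap_conjugate n E \<mu> (alg_conn n E)" if "real (lap_mult n E \<mu>) = (real n - 1) / 2 - 2"
  proof -
    have a: "alg_conn n E = (3 - sqrt 5) / 2" "lap_mult n E \<mu> = k - 1" using fwd[OF that] bwd by auto
    then have "(alg_conn n E)\<^sup>2 - 3 * alg_conn n E + 1 = 0" using golden_roots by blast
    then show ?thesis using lap_conjugate_golden[OF sg] fwd[OF that] a(2) k(3) by simp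
  qed
  show ?thesis
    unfolding m_def[symmetric] k(1,2) golden_roots[symmetric] using fwd bwd conj by blast
qed

end
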